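(* Let $k$ be an integer and let $G$ be a connected bipartite graph with bipartition classes $A$ and $B$, where $|A|=a$, $|B|=b$ and $b \ge a \ge k/2 \ge 4$. Suppose $G$ contains no path on $k$ vertices as a subgraph. Write $t = \lfloor (k-3)/2 \rfloor$. Then \[ |E(G)| \le t\, b + (a - t). \] Moreover, equality holds exactly in the following cases. If $k$ is odd, equality holds if and only if $G$ is isomorphic to the graph $B_1(a,b,k)$ obtained from the complete bipartite graph $K_{t,\,b}$ (with parts of sizes $t$ and $b$, the latter being the class $B$) by adding $a-t$ new pairwise non-adjacent vertices, each adjacent to the same single vertex of the part of size $b$. If $k$ is even, equality holds if and only if $G$ belongs to the family $\mathcal{B}_1(a,b,k)$ of graphs obtained from $K_{t,\,b}$ (with parts of sizes $t$ and $b$, the latter being the class $B$) by adding $a-t$ new pairwise non-adjacent vertices, each adjacent to exactly one (arbitrary, not necessarily the same) vertex of the part of size $b$.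
   Context: All graphs are finite, simple and undirected. $P_k$ denotes the path on $k$ vertices; $G$ being $P_k$-free means $G$ has no subgraph isomorphic to $P_k$. *)

theory Defs
  imports Complex_Main
begin

record 'a ugraph =
  verts :: "'a set"
  edges :: "'a set set"

definition simple_graph :: "'a ugraph \<Rightarrow> bool" where
  "simple_graph G \<longleftrightarrow>
     finite (verts G) \<and> (\<forall>e\<in>edges G. e \<subseteq> verts G \<and> card e = 2)"

definition subgraph :: "'a ugraph \<Rightarrow> 'a ugraph \<Rightarrow> bool" where
  "subgraph H G \<longleftrightarrow> simple_graph H \<and> verts H \<subseteq> verts G \<and> edges H \<subseteq> edges G"

definition graph_iso :: "'a ugraph \<Rightarrow> 'b ugraph \<Rightarrow> bool" (infix "\<simeq>\<^sub>g" 50) where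
  "G \<simeq>\<^sub>g H \<longleftrightarrow>
     (\<exists>f. bij_betw f (verts G) (verts H) \<and>
          (\<forall>u\<in>verts G. \<forall>v\<in>verts G. {u, v} \<in> edges G \<longleftrightarrow> {f u, f v} \<in> edges H))"

definition connected_graph :: "'a ugraph \<Rightarrow> bool" where
  "connected_graph G \<longleftrightarrow>
     verts G \<noteq> {} \<and>
     (\<forall>u\<in>verts G. \<forall>v\<in>verts G. (\<lambda>x y. {x, y} \<in> edges G)\<^sup>*\<^sup>* u v)"

definition bipartition :: "'a ugraph \<Rightarrow> 'a set \<Rightarrow> 'a set \<Rightarrow> bool" where
  "bipartition G A B \<longleftrightarrow>
     A \<union> B = verts G \<and> A \<inter> B = {} \<and> (\<forall>e\<in>edges G. \<exists>x\<in>A. \<exists>y\<in>B. e = {x, y})"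

definition path_graph :: "nat \<Rightarrow> nat ugraph" where
  "path_graph k = \<lparr>verts = {..<k}, edges = {{i, Suc i} | i. Suc i < k}\<rparr>"

definition path_free :: "nat \<Rightarrow> 'a ugraph \<Rightarrow> bool" where
  "path_free k G \<longleftrightarrow> \<not> (\<exists>H. subgraph H G \<and> H \<simeq>\<^sub>g path_graph k)"

definition complete_bipartite :: "nat \<Rightarrow> nat \<Rightarrow> (nat + nat) ugraph" where
  "complete_bipartite m n =
     \<lparr>verts = Inl ` {..<m} \<union> Inr ` {..<n},
      edges = {{Inl i, Inr j} | i j. i < m \<and> j < n}\<rparr>"

definition t_par :: "nat \<Rightarrow> nat" where
  "t_par k = nat \<lfloor>(real k - 3) / 2\<rfloor>"

text \<open>
  The new vertices are \<open>Inl i\<close> for \<open>t \<le> i < a\<close>, and \<open>f i\<close> is the index of the unique neighbour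
  of \<open>Inl i\<close> in the part of size \<open>b\<close>. Thus the vertices \<open>Inl i\<close> and \<open>Inr j\<close> form the classes
  of sizes \<open>a\<close> and \<open>b\<close>, respectively.
\<close>

definition pendant_extension :: "nat \<Rightarrow> nat \<Rightarrow> nat \<Rightarrow> (nat \<Rightarrow> nat) \<Rightarrow> (nat + nat) ugraph" where
  "pendant_extension t a b f =
     \<lparr>verts = verts (complete_bipartite t b) \<union> Inl ` {t..<a},
      edges = edges (complete_bipartite t b) \<union> {{Inl i, Inr (f i)} | i. i \<in> {t..<a}}\<rparr>"

text \<open>
  For positive \<open>b\<close>, choosing another vertex than \<open>Inr 0\<close> as the common neighbour gives an
  isomorphic graph.
\<close>

definition B1_graph :: "nat \<Rightarrow> nat \<Rightarrow> nat \<Rightarrow> (nat + nat) ugraph" where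
  "B1_graph a b k = pendant_extension (t_par k) a b (\<lambda>_. 0)"

definition B1_family :: "nat \<Rightarrow> nat \<Rightarrow> nat \<Rightarrow> (nat + nat) ugraph set" where
  "B1_family a b k =
     {pendant_extension (t_par k) a b f | f. \<forall>i\<in>{t_par k..<a}. f i < b}"

end

theory Submission
  imports Defs
begin

text \<open>
  Put \<open>s = t + 2\<close>, so that \<open>k\<close> is \<open>2 s\<close> or \<open>2 s - 1\<close>; for everything except the position of the
  pendant vertices when \<open>k\<close> is odd, it is enough that there is no path on \<open>2 s\<close> vertices.
  Let \<open>P\<close> be a longest path. If its ends lie in different classes, the absence of a cycle through
  all of \<open>P\<close> gives two ends with degree sum at most \<open>t + 1\<close>. If both lie in \<open>A\<close>, then \<open>B\<close> has the
  majority outside \<open>P\<close>, so a depth-first search outside \<open>P\<close> has a leaf \<open>z\<close> in \<open>B\<close>, and a chord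
  argument shows that the degrees of \<open>z\<close> and of an end of \<open>P\<close> add up to at most \<open>t + 1\<close>. If both lie
  in \<open>B\<close>, an end of \<open>P\<close> has degree at most \<open>t\<close>. Hence for \<open>a < b\<close> a non-cut vertex of \<open>B\<close> of degree
  at most \<open>t\<close> can be deleted, and for \<open>a = b > s\<close> a pair of vertices with degree sum at most
  \<open>t + 1\<close>; both deletions match the decrease of the bound. In the remaining case \<open>a = b = s\<close>
  the rotations of Posa at an end of maximal degree produce many ends of small degree,
  hence at least \<open>2 (s - 1)\<close> non-adjacent pairs.
\<close>

section \<open>Paths and connectivity in a symmetric relation\<close>

text \<open>The bound drops by \<open>t\<close> when \<open>b\<close> drops by one, and by
  \<open>t + 1\<close> when each class loses a vertex; this fixes the degrees asked of deletable
  vertices. A small degree alone does not suffice, because the bound fails without connectivity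
  (take \<open>K_{t+1,b}\<close> and isolated vertices in the other class). The deleted vertices are
  therefore ends of longest paths and leaves of a search: all their neighbours lie on a path or
  branch that survives the deletion. The induction cannot descend below \<open>a = s\<close>, since
  \<open>K_{s-1,b}\<close> has no path on \<open>2 s\<close> vertices but more edges than the
  formula allows. So the square \<open>a = b = s\<close>, where the bound reads
  \<open>s^2 - 2 (s - 1)\<close>, has to be settled directly. For equality the structure is carried
  back through the deletions. When \<open>a = b\<close> the classes are interchangeable, so the
  statement proved by induction has two orientations, and the wrong one has to be excluded as soon
  as \<open>a < b\<close>.\<close>

locale sym_graph =
  fixes R :: "'a \<Rightarrow> 'a \<Rightarrow> bool"
  assumes sym: "R x y \<Longrightarrow> R y x"
begin

definition nbrs :: "'a set \<Rightarrow> 'a \<Rightarrow> 'a set" where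
  "nbrs X v = {u \<in> X. R v u}"

definition is_path :: "'a set \<Rightarrow> 'a list \<Rightarrow> bool" where
  "is_path V xs \<longleftrightarrow> xs \<noteq> [] \<and> distinct xs \<and> set xs \<subseteq> V \<and> successively R xs"

definition longest_path :: "'a set \<Rightarrow> 'a list \<Rightarrow> bool" where
  "longest_path V P \<longleftrightarrow> is_path V P \<and> (\<forall>xs. is_path V xs \<longrightarrow> length xs \<le> length P)"

text \<open>Both ends of each step lie in \<open>X\<close>, so this is reachability in the subgraph
  induced by \<open>X\<close>; it is reflexive also at vertices outside \<open>X\<close>.\<close>

definition reach :: "'a set \<Rightarrow> 'a \<Rightarrow> 'a \<Rightarrow> bool" where
  "reach X = (\<lambda>x y. R x y \<and> x \<in> X \<and> y \<in> X)\<^sup>*\<^sup>*"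

definition conn :: "'a set \<Rightarrow> bool" where
  "conn V \<longleftrightarrow> (\<forall>u\<in>V. \<forall>v\<in>V. reach V u v)"

definition component :: "'a set \<Rightarrow> 'a \<Rightarrow> 'a set" where
  "component U v = {u \<in> U. reach U v u}"

lemma nbrs_iff [simp]: "u \<in> nbrs X v \<longleftrightarrow> u \<in> X \<and> R v u"
  by (simp add: nbrs_def)

lemma finite_nbrs [simp]: "finite X \<Longrightarrow> finite (nbrs X v)"
  by (simp add: nbrs_def)

lemma is_path_join:
  assumes "is_path V xs" "is_path V ys" "set xs \<inter> set ys = {}" "R (last xs) (hd ys)"
  shows "is_path V (xs @ ys)"
  using assms by (auto simp: is_path_def successively_append_iff)

lemma is_path_rev: "is_path V xs \<Longrightarrow> is_path V (rev xs)"
  unfolding is_path_def by (auto intro: successively_mono[of R] simp: sym)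

lemma is_path_take: "is_path V xs \<Longrightarrow> 0 < n \<Longrightarrow> is_path V (take n xs)"
  unfolding is_path_def
  using set_take_subset[of n xs] append_take_drop_id[of n xs] successively_append_iff
  by (metis distinct_take subset_trans take_eq_Nil less_numeral_extra(3))

lemma is_path_drop: "is_path V xs \<Longrightarrow> n < length xs \<Longrightarrow> is_path V (drop n xs)"
  unfolding is_path_def
  using set_drop_subset[of n xs] append_take_drop_id[of n xs] successively_append_iff
  by (metis distinct_drop subset_trans drop_eq_Nil linorder_not_less)

lemma is_path_subset: "is_path V xs \<Longrightarrow> V \<subseteq> W \<Longrightarrow> is_path W xs"
  by (auto simp: is_path_def)

lemma is_path_single: "v \<in> V \<Longrightarrow> is_path V [v]"
  by (simp add: is_path_def)

lemma is_path_snoc: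
  assumes "is_path V xs" "v \<in> V" "v \<notin> set xs" "R (last xs) v"
  shows "is_path V (xs @ [v])"
  using is_path_join[OF assms(1) is_path_single[OF assms(2)]] assms by simp

lemma is_path_nth: "is_path V xs \<Longrightarrow> Suc i < length xs \<Longrightarrow> R (xs ! i) (xs ! Suc i)"
  by (simp add: is_path_def successively_conv_nth)

lemma is_path_ends: "is_path V xs \<Longrightarrow> hd xs \<in> V" "is_path V xs \<Longrightarrow> last xs \<in> V"
  "is_path V xs \<Longrightarrow> hd xs \<in> set xs" "is_path V xs \<Longrightarrow> last xs \<in> set xs"
  unfolding is_path_def by (meson hd_in_set last_in_set subsetD)+

lemma is_path_in: "is_path V xs \<Longrightarrow> i < length xs \<Longrightarrow> xs ! i \<in> V"
  by (auto simp: is_path_def)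

lemma longest_rev: "longest_path V P \<Longrightarrow> longest_path V (rev P)"
  by (simp add: longest_path_def is_path_rev)

lemma longestD: "longest_path V P \<Longrightarrow> is_path V xs \<Longrightarrow> length xs \<le> length P"
  by (simp add: longest_path_def)

lemma longest_is_path: "longest_path V P \<Longrightarrow> is_path V P"
  by (simp add: longest_path_def)

lemma longest_ex:
  assumes "finite V" "V \<noteq> {}"
  obtains P where "longest_path V P"
proof -
  obtain v where "v \<in> V" using assms by blast
  then have p: "is_path V [v]" by (rule is_path_single)
  have bd: "\<forall>xs. is_path V xs \<longrightarrow> length xs < Suc (card V)"
    using assms by (auto simp: is_path_def less_Suc_eq_le distinct_card[symmetric] card_mono)
  show ?thesis
    using ex_has_greatest_nat[of "is_path V" "[v]" length, OF p bd] that
    by (auto simp: longest_path_def less_imp_le)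
qed

lemma longest_hd_nbr:
  assumes "longest_path V P" "R (hd P) w" "w \<in> V"
  shows "w \<in> set P"
proof (rule ccontr)
  assume "w \<notin> set P"
  then have "is_path V ([w] @ P)"
    using assms by (intro is_path_join is_path_single) (auto simp: longest_path_def sym)
  from longestD[OF assms(1) this] show False by simp
qed

lemma longest_last_nbr:
  assumes "longest_path V P" "R (last P) w" "w \<in> V"
  shows "w \<in> set P"
  using longest_hd_nbr[OF longest_rev[OF assms(1)], of w] assms by (simp add: hd_rev)

lemma disjoint_take_drop:
  "is_path V P \<Longrightarrow> i \<le> j \<Longrightarrow> set (take i P) \<inter> set (drop j P) = {}"
  by (simp add: is_path_def set_take_disj_set_drop_if_distinct)

lemma last_take_Suc: "i < length P \<Longrightarrow> last (take (Suc i) P) = P ! i"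
  by (simp add: take_Suc_conv_app_nth)

lemma hd_take_Suc: "hd (take (Suc i) P) = hd P"
  by (cases P) auto

text \<open>Posa rotation: the chord from the head to position \<open>Suc j\<close> replaces the
  edge between positions \<open>j\<close> and \<open>Suc j\<close>, so the initial segment is
  reversed and the other end stays fixed.\<close>

lemma is_path_rotate:
  assumes P: "is_path V P" and j: "Suc j < length P" and e: "R (hd P) (P ! Suc j)"
  defines "P' \<equiv> rev (take (Suc j) P) @ drop (Suc j) P"
  shows "is_path V P'" "hd P' = P ! j" "last P' = last P" "length P' = length P"
    "set P' = set P"
proof -
  have ne: "P \<noteq> []" using j by auto
  show "is_path V P'" unfolding P'_def
    using P j e disjoint_take_drop[OF P, of "Suc j" "Suc j"]
    by (intro is_path_join is_path_rev is_path_take is_path_drop)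
      (auto simp: last_rev hd_take_Suc hd_drop_conv_nth)
  show "hd P' = P ! j" using j ne by (simp add: P'_def hd_append hd_rev last_take_Suc)
  show "last P' = last P" using j by (simp add: P'_def)
  show "length P' = length P" using j by (simp add: P'_def)
  show "set P' = set P"
    unfolding P'_def by (metis append_take_drop_id set_append set_rev)
qed

lemma tail_end:
  assumes P: "longest_path V P" and Q: "is_path (V - set P) Q"
    and i: "i < length P" "R (P ! i) (hd Q)"
  shows "is_path V (take (Suc i) P @ Q)" and "i + length Q < length P"
proof -
  have Pp: "is_path V P" using P by (rule longest_is_path)
  have Qp: "is_path V Q" using Q by (rule is_path_subset) auto
  have "set (take (Suc i) P) \<inter> set Q = {}"
    using Q set_take_subset[of "Suc i" P] by (auto simp: is_path_def)
  then show TQ: "is_path V (take (Suc i) P @ Q)"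
    using Pp Qp i by (intro is_path_join is_path_take) (auto simp: last_take_Suc)
  show "i + length Q < length P" using longestD[OF P TQ] i by simp
qed

text \<open>\<open>Q\<close> can replace the part of \<open>P\<close> strictly between positions
  \<open>i\<close> and \<open>j\<close>, so that part has at least as many vertices as
  \<open>Q\<close>.\<close>

lemma tail_insert:
  assumes P: "longest_path V P" and Q: "is_path (V - set P) Q"
    and i: "i < length P" "R (P ! i) (hd Q)"
    and j: "i < j" "j < length P" "R (last Q) (P ! j)"
  shows "i + length Q < j"
proof -
  note TQ = tail_end(1)[OF P Q i] and Pp = longest_is_path[OF P]
  have "Q \<noteq> []" using Q by (simp add: is_path_def)
  moreover have "set (drop j P) \<inter> set Q = {}"
    using Q set_drop_subset[of j P] by (auto simp: is_path_def)
  moreover have "set (take (Suc i) P) \<inter> set (drop j P) = {}"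
    using disjoint_take_drop[OF Pp, of "Suc i" j] j by simp
  ultimately have "is_path V ((take (Suc i) P @ Q) @ drop j P)"
    using j by (intro is_path_join[OF TQ is_path_drop[OF Pp]]) (auto simp: hd_drop_conv_nth)
  from longestD[OF P this] i j show ?thesis by simp
qed

text \<open>The competing path runs backwards through \<open>Q\<close>, from position
  \<open>i\<close> back to the head, over the chord to position \<open>j\<close> and on to the end.
  It gains \<open>Q\<close> and loses only the vertices strictly between \<open>i\<close> and
  \<open>j\<close>.\<close>

lemma tail_chord:
  assumes P: "longest_path V P" and Q: "is_path (V - set P) Q"
    and i: "i < length P" "R (P ! i) (hd Q)"
    and j: "i < j" "j < length P" "R (hd P) (P ! j)"
  shows "i + length Q < j"
proof -
  note TQ = tail_end(1)[OF P Q i] and Pp = longest_is_path[OF P]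
  have "set (drop j P) \<inter> set Q = {}"
    using Q set_drop_subset[of j P] by (auto simp: is_path_def)
  moreover have "set (take (Suc i) P) \<inter> set (drop j P) = {}"
    using disjoint_take_drop[OF Pp, of "Suc i" j] j by simp
  moreover have "last (rev (take (Suc i) P @ Q)) = hd P"
    using Pp by (subst last_rev) (auto simp: hd_append hd_take_Suc is_path_def)
  ultimately have "is_path V (rev (take (Suc i) P @ Q) @ drop j P)"
    using j by (intro is_path_join[OF is_path_rev[OF TQ] is_path_drop[OF Pp]])
      (auto simp: hd_drop_conv_nth simp del: rev_append)
  from longestD[OF P this] i j show ?thesis by simp
qed

lemma is_path_rotate_last:
  assumes P: "is_path V P" and j: "Suc j < length P" and e: "R (last P) (P ! j)"
  defines "P' \<equiv> take (Suc j) P @ rev (drop (Suc j) P)"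
  shows "is_path V P'" "hd P' = hd P" "last P' = P ! Suc j" "length P' = length P"
    "set P' = set P"
proof -
  have ne: "P \<noteq> []" using j by auto
  show "is_path V P'" unfolding P'_def
    using P j e disjoint_take_drop[OF P, of "Suc j" "Suc j"]
    by (intro is_path_join is_path_rev is_path_take is_path_drop)
      (auto simp: hd_rev last_take_Suc dest: sym)
  show "hd P' = hd P" using ne by (simp add: P'_def hd_append hd_take_Suc)
  show "last P' = P ! Suc j" using j by (simp add: P'_def last_rev hd_drop_conv_nth)
  show "length P' = length P" using j by (simp add: P'_def)
  show "set P' = set P"
    unfolding P'_def by (metis append_take_drop_id set_append set_rev)
qed

lemma longest_cong: "longest_path V P \<Longrightarrow> is_path V P' \<Longrightarrow> length P' = length P \<Longrightarrow> longest_path V P'"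
  by (simp add: longest_path_def)

section \<open>Reachability and connected vertex sets\<close>

lemma reach_refl [simp]: "reach X u u"
  by (simp add: reach_def)

lemma reach_trans: "reach X u v \<Longrightarrow> reach X v w \<Longrightarrow> reach X u w"
  by (simp add: reach_def)

lemma reach_edge: "R u v \<Longrightarrow> u \<in> X \<Longrightarrow> v \<in> X \<Longrightarrow> reach X u v"
  by (auto simp: reach_def)

lemma reach_mono:
  assumes "reach X u v" "X \<subseteq> Y"
  shows "reach Y u v"
proof -
  have "(\<lambda>x y. R x y \<and> x \<in> X \<and> y \<in> X) \<le> (\<lambda>x y. R x y \<and> x \<in> Y \<and> y \<in> Y)"
    using assms(2) by auto
  from rtranclp_mono[OF this] show ?thesis using assms(1) by (auto simp: reach_def)
qed

lemma reach_sym: "reach X u v \<Longrightarrow> reach X v u"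
  unfolding reach_def
  by (rule sympD[OF symp_rtranclp]) (auto intro!: sympI dest: sym)

lemma connI_root:
  assumes "\<And>v. v \<in> V \<Longrightarrow> reach V r v"
  shows "conn V"
  unfolding conn_def using assms reach_sym reach_trans by blast

lemma conn_path:
  assumes "is_path V xs"
  shows "conn (set xs)"
proof (rule connI_root)
  have "reach (set xs) (xs ! 0) (xs ! i)" if "i < length xs" for i
    using that
  proof (induction i)
    case (Suc i)
    have "reach (set xs) (xs ! i) (xs ! Suc i)"
      using is_path_nth[OF assms Suc.prems] Suc.prems by (intro reach_edge) auto
    then show ?case using Suc reach_trans by (meson Suc_lessD)
  qed simp
  then show "reach (set xs) (xs ! 0) v" if "v \<in> set xs" for v
    using that by (metis in_set_conv_nth)
qed

lemma conn_union:
  assumes "conn K" "conn L" "u \<in> K" "v \<in> L" "R u v"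
  shows "conn (K \<union> L)"
proof (rule connI_root[of _ u])
  fix w assume "w \<in> K \<union> L"
  moreover have "reach (K \<union> L) u v" using assms by (intro reach_edge) auto
  moreover have "reach (K \<union> L) u w" if "w \<in> K"
    using assms that by (auto simp: conn_def intro: reach_mono[of K])
  moreover have "reach (K \<union> L) v w" if "w \<in> L"
    using assms that by (auto simp: conn_def intro: reach_mono[of L])
  ultimately show "reach (K \<union> L) u w" using reach_trans by blast
qed

text \<open>A walk through \<open>x\<close> enters and leaves it by vertices of \<open>C\<close>,
  and can be rerouted inside \<open>C\<close>.\<close>

lemma conn_remove:
  assumes V: "conn V" and C: "conn C" "C \<noteq> {}" "C \<subseteq> V - {x}" and nb: "nbrs V x \<subseteq> C"
  shows "conn (V - {x})"
proof -
  obtain c where c: "c \<in> C" using C by blast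
  have reachC: "reach (V - {x}) c w" if "w \<in> C" for w
    using C c that by (auto simp: conn_def intro: reach_mono)
  \<comment> \<open>Induction along a walk in \<open>V\<close>. The claim is void while the walk
    stands at \<open>x\<close>; the next vertex then lies in \<open>C\<close> and is reached afresh
    from \<open>c\<close>.\<close>
  have "(w \<noteq> x \<longrightarrow> reach (V - {x}) c w)" if "reach V c w" for w
    using that unfolding reach_def[of V]
  proof (induction rule: rtranclp_induct)
    case (step v w)
    show ?case
    proof
      assume "w \<noteq> x"
      show "reach (V - {x}) c w"
      proof (cases "v = x")
        case True
        then have "w \<in> C" using step nb by auto
        then show ?thesis by (rule reachC)
      next
        case False
        then show ?thesis
          using step \<open>w \<noteq> x\<close> by (meson DiffI reach_edge reach_trans singletonD)
      qed
    qed
  qed simp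
  then show ?thesis
    using V C c by (intro connI_root[of _ c]) (auto simp: conn_def)
qed

section \<open>Components and averaging over them\<close>

lemma reach_exit:
  assumes "reach V v w" "v \<in> U" "w \<notin> U"
  obtains u w' where "u \<in> component U v" "w' \<in> V - U" "R u w'"
proof -
  have "w \<in> component U v \<or> (\<exists>u\<in>component U v. \<exists>w'\<in>V - U. R u w')"
    using assms(1) unfolding reach_def
  proof (induction rule: rtranclp_induct)
    case base
    then show ?case using assms(2) by (simp add: component_def)
  next
    case (step y z)
    show ?case
    proof (cases "y \<in> component U v \<and> z \<in> U")
      case True
      then have "reach U v z"
        using step(2) reach_edge[of y z U] reach_trans by (auto simp: component_def)
      then show ?thesis using True by (simp add: component_def)
    qed (use step in blast)
  qed
  then show ?thesis using that assms(3) by (auto simp: component_def)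
qed

lemma comp_self: "v \<in> U \<Longrightarrow> v \<in> component U v"
  by (simp add: component_def)

lemma comp_subset: "component U v \<subseteq> U"
  by (auto simp: component_def)

lemma comp_eq: "w \<in> component U v \<Longrightarrow> component U w = component U v"
  unfolding component_def by (auto dest: reach_sym intro: reach_trans)

lemma comp_nbr: "u \<in> component U v \<Longrightarrow> w \<in> U \<Longrightarrow> R u w \<Longrightarrow> w \<in> component U v"
  unfolding component_def by (auto intro: reach_trans reach_edge)

lemma reach_comp:
  assumes "reach U v w" "v \<in> U"
  shows "reach (component U v) v w"
  using assms(1) unfolding reach_def[of U]
proof (induction rule: rtranclp_induct)
  case (step y z)
  have "y \<in> component U v"
    using step assms(2) by (simp add: component_def reach_def)
  then show ?case using step comp_nbr reach_edge reach_trans by metis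
qed simp

lemma conn_comp:
  assumes "v \<in> U"
  shows "conn (component U v)"
  by (rule connI_root[of _ v]) (use assms in \<open>auto simp: component_def intro: reach_comp[unfolded component_def]\<close>)

lemma card_Int_comps:
  assumes "finite U"
  shows "card (U \<inter> X) = (\<Sum>D\<in>component U ` U. card (D \<inter> X))"
proof -
  have "U \<inter> X = (\<Union>D\<in>component U ` U. D \<inter> X)"
    using comp_self comp_subset by fastforce
  also have "card \<dots> = (\<Sum>D\<in>component U ` U. card (D \<inter> X))"
  proof (rule card_UN_disjoint)
    show "\<forall>D\<in>component U ` U. finite (D \<inter> X)"
      using assms comp_subset finite_subset by blast
    show "\<forall>D\<in>component U ` U. \<forall>D'\<in>component U ` U. D \<noteq> D' \<longrightarrow> D \<inter> X \<inter> (D' \<inter> X) = {}"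
      using comp_eq by blast
  qed (use assms in simp)
  finally show ?thesis .
qed

lemma comp_majority:
  assumes "finite U" "card (U \<inter> X) < card (U \<inter> Y)"
  obtains v where "v \<in> U" "card (component U v \<inter> X) < card (component U v \<inter> Y)"
proof -
  have "\<not> (\<forall>v\<in>U. card (component U v \<inter> Y) \<le> card (component U v \<inter> X))"
  proof
    assume "\<forall>v\<in>U. card (component U v \<inter> Y) \<le> card (component U v \<inter> X)"
    then have "card (U \<inter> Y) \<le> card (U \<inter> X)"
      unfolding card_Int_comps[OF assms(1)] by (intro sum_mono) auto
    then show False using assms by simp
  qed
  then show ?thesis using that by (meson not_le)
qed

lemma comp_majority_weak:
  assumes "finite U" "U \<noteq> {}" "card (U \<inter> X) \<le> card (U \<inter> Y)"
  obtains v where "v \<in> U" "card (component U v \<inter> X) \<le> card (component U v \<inter> Y)"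
proof -
  have "\<not> (\<forall>v\<in>U. card (component U v \<inter> Y) < card (component U v \<inter> X))"
  proof
    assume "\<forall>v\<in>U. card (component U v \<inter> Y) < card (component U v \<inter> X)"
    then have "card (U \<inter> Y) < card (U \<inter> X)"
      unfolding card_Int_comps[OF assms(1)] using assms by (intro sum_strict_mono) auto
    then show False using assms by simp
  qed
  then show ?thesis using that by (meson not_le)
qed

end

section \<open>Depth-first search and crossing chords in bipartite graphs\<close>

lemma card_odd_less: "card {j. j < l \<and> odd j} = l div (2::nat)"
proof (induction l)
  case (Suc l)
  have "{j. j < Suc l \<and> odd j} = (if odd l then insert l {j. j < l \<and> odd j} else {j. j < l \<and> odd j})"
    by (auto simp: less_Suc_eq)
  then show ?case using Suc by (auto elim!: oddE)
qed simp

locale bip = sym_graph R for R :: "'a \<Rightarrow> 'a \<Rightarrow> bool" +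
  fixes A B :: "'a set"
  assumes finA [simp]: "finite A" and finB [simp]: "finite B"
    and disj: "A \<inter> B = {}"
    and indepA: "x \<in> A \<Longrightarrow> y \<in> A \<Longrightarrow> \<not> R x y"
    and indepB: "x \<in> B \<Longrightarrow> y \<in> B \<Longrightarrow> \<not> R x y"
begin

abbreviation V :: "'a set" where "V \<equiv> A \<union> B"

lemma swapped: "bip R B A"
  by unfold_locales (use disj indepA indepB in auto)

lemma sub:
  assumes "A' \<subseteq> A" "B' \<subseteq> B"
  shows "bip R A' B'"
proof
  show "finite A'" "finite B'" using assms finite_subset[OF _ finA] finite_subset[OF _ finB] by auto
  show "A' \<inter> B' = {}" using assms disj by auto
  show "\<not> R x y" if "x \<in> A'" "y \<in> A'" for x y using that assms indepA[of x y] by auto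
  show "\<not> R x y" if "x \<in> B'" "y \<in> B'" for x y using that assms indepB[of x y] by auto
qed

lemma nbrs_A: "x \<in> A \<Longrightarrow> nbrs V x = nbrs B x"
  using indepA by (auto simp: nbrs_def)

lemma nbrs_B: "x \<in> B \<Longrightarrow> nbrs V x = nbrs A x"
  using indepB by (auto simp: nbrs_def)

lemma path_parity:
  assumes P: "is_path V P" and h: "hd P \<in> A" and "j < length P"
  shows "P ! j \<in> A \<longleftrightarrow> even j" and "P ! j \<in> B \<longleftrightarrow> odd j"
proof -
  have "P ! j \<in> (if even j then A else B)" using assms(3)
  proof (induction j)
    case 0
    then show ?case using h by (simp add: hd_conv_nth)
  next
    case (Suc j)
    have "R (P ! j) (P ! Suc j)" "P ! Suc j \<in> V"
      using is_path_nth[OF P Suc.prems] is_path_in[OF P Suc.prems] by auto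
    then show ?case using Suc indepA indepB by (auto split: if_splits)
  qed
  then show "P ! j \<in> A \<longleftrightarrow> even j" "P ! j \<in> B \<longleftrightarrow> odd j"
    using disj by (auto split: if_splits)
qed

text \<open>
  Depth-first search: \<open>Q\<close> is the current branch and \<open>U\<close> the set of vertices still to be explored
  below its end. If \<open>B\<close> has the majority in \<open>U\<close>, then it has the majority in a component of \<open>U\<close>,
  which leads to a leaf of the search tree in \<open>B\<close>.
\<close>

lemma dfs_leaf:
  assumes "is_path (V - S) Q" "U \<subseteq> V - S - set Q"
    and "\<And>u. u \<in> insert (last Q) U \<Longrightarrow> nbrs V u \<subseteq> U \<union> set Q \<union> S"
    and "\<And>u. u \<in> U \<Longrightarrow> reach (insert (last Q) U) u (last Q)"
    and "card (U \<inter> A) + (if last Q \<in> A then 1 else 0) \<le> card (U \<inter> B)"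
  shows "\<exists>Q'. is_path (V - S) Q' \<and> hd Q' = hd Q \<and> last Q' \<in> B \<and> nbrs V (last Q') \<subseteq> set Q' \<union> S"
  using assms
proof (induction "card U" arbitrary: Q U rule: less_induct)
  case less
  note Q = less.prems(1) and U = less.prems(2) and nb = less.prems(3) and rc = less.prems(4)
  let ?r = "last Q"
  have finU: "finite U" using U by (meson finA finB finite_Diff finite_UnI finite_subset)
  have rV: "?r \<in> V - S" "?r \<in> set Q" using is_path_ends(2,4)[OF Q] .
  have descend: ?case
    if v: "v \<in> U" and m: "\<And>r1. r1 \<in> component U v \<Longrightarrow> R ?r r1 \<Longrightarrow>
      card ((component U v - {r1}) \<inter> A) + (if r1 \<in> A then 1 else 0) \<le> card ((component U v - {r1}) \<inter> B)" for v
  proof -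
    let ?D = "component U v"
    have "?r \<notin> U" using U rV by auto
    \<comment> \<open>The only vertex of \<open>insert ?r U\<close> outside \<open>U\<close> is
      \<open>?r\<close>, so the edge that leaves the component ends there.\<close>
    with reach_exit[OF rc[OF v] v]
    obtain r1 where r1: "r1 \<in> ?D" "R r1 ?r" by auto
    have DU: "?D \<subseteq> U" by (rule comp_subset)
    have eqD: "insert (last (Q @ [r1])) (?D - {r1}) = ?D" using r1 by auto
    have "\<exists>Q'. is_path (V - S) Q' \<and> hd Q' = hd (Q @ [r1]) \<and> last Q' \<in> B \<and> nbrs V (last Q') \<subseteq> set Q' \<union> S"
    proof (rule less.hyps)
      show "card (?D - {r1}) < card U"
        using r1 DU finU by (intro psubset_card_mono) auto
      show "is_path (V - S) (Q @ [r1])"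
        using r1 DU U Q by (intro is_path_snoc) (auto dest: sym)
      show "?D - {r1} \<subseteq> V - S - set (Q @ [r1])" using DU U by auto
      show "nbrs V u \<subseteq> ?D - {r1} \<union> set (Q @ [r1]) \<union> S"
        if "u \<in> insert (last (Q @ [r1])) (?D - {r1})" for u
      proof
        fix w assume w: "w \<in> nbrs V u"
        have u: "u \<in> ?D" using that eqD by blast
        have "w \<in> U \<union> set Q \<union> S" using w u nb DU by blast
        moreover have "w \<in> ?D" if "w \<in> U" using comp_nbr[OF u that] w by simp
        ultimately show "w \<in> ?D - {r1} \<union> set (Q @ [r1]) \<union> S" by auto
      qed
      show "reach (insert (last (Q @ [r1])) (?D - {r1})) u (last (Q @ [r1]))"
        if "u \<in> ?D - {r1}" for u
        unfolding eqD using conn_comp[OF v] that r1 by (auto simp: conn_def)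
      show "card ((?D - {r1}) \<inter> A) + (if last (Q @ [r1]) \<in> A then 1 else 0) \<le> card ((?D - {r1}) \<inter> B)"
        using m[OF r1(1)] r1 by (auto dest: sym)
    qed
    moreover have "hd (Q @ [r1]) = hd Q" using Q by (simp add: is_path_def)
    ultimately show ?thesis by simp
  qed
  \<comment> \<open>The inequality charges the current end when it lies in \<open>A\<close>. An end
    in \<open>A\<close> thus leaves \<open>B\<close> a strict majority, from which \<open>r1\<close>
    in \<open>B\<close> may be taken; an end in \<open>B\<close> leaves a weak one, and then
    \<open>r1\<close> in \<open>A\<close> merely passes from the count of \<open>U\<close> to the
    charge for the end.\<close>
  show ?case
  proof (cases "?r \<in> A")
    case True
    then have "card (U \<inter> A) < card (U \<inter> B)" using less.prems(5) by simp
    from comp_majority[OF finU this]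
    obtain v where v: "v \<in> U" "card (component U v \<inter> A) < card (component U v \<inter> B)" .
    show ?thesis
    proof (rule descend[OF v(1)])
      fix r1 assume r1: "r1 \<in> component U v" "R ?r r1"
      then have "r1 \<in> B" "r1 \<notin> A"
        using True indepA disj U comp_subset[of U v] by blast+
      then have "(component U v - {r1}) \<inter> A = component U v \<inter> A"
        "(component U v - {r1}) \<inter> B = component U v \<inter> B - {r1}" by auto
      then show "card ((component U v - {r1}) \<inter> A) + (if r1 \<in> A then 1 else 0)
          \<le> card ((component U v - {r1}) \<inter> B)"
        using v r1 \<open>r1 \<in> B\<close> \<open>r1 \<notin> A\<close> by simp
    qed
  next
    case False
    then have rB: "?r \<in> B" using rV by auto
    show ?thesis
    proof (cases "U = {}")
      case True
      then show ?thesis using Q rB nb[of ?r] by (intro exI[of _ Q]) auto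
    next
      case ne: False
      have "card (U \<inter> A) \<le> card (U \<inter> B)" using less.prems(5) by simp
      from comp_majority_weak[OF finU ne this]
      obtain v where v: "v \<in> U" "card (component U v \<inter> A) \<le> card (component U v \<inter> B)" .
      show ?thesis
      proof (rule descend[OF v(1)])
        fix r1 assume r1: "r1 \<in> component U v" "R ?r r1"
        then have "r1 \<in> A" "r1 \<notin> B"
          using rB indepB disj U comp_subset[of U v] by blast+
        then have "(component U v - {r1}) \<inter> B = component U v \<inter> B"
          "(component U v - {r1}) \<inter> A = component U v \<inter> A - {r1}" by auto
        moreover have "card (component U v \<inter> A) > 0"
          using r1 \<open>r1 \<in> A\<close> by (auto simp: card_gt_0_iff)
        ultimately show "card ((component U v - {r1}) \<inter> A) + (if r1 \<in> A then 1 else 0)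
            \<le> card ((component U v - {r1}) \<inter> B)"
          using v r1 \<open>r1 \<in> A\<close> by simp
      qed
    qed
  qed
qed

text \<open>By connectivity a component of \<open>V - S\<close> in which \<open>B\<close> has the
  majority is attached to \<open>S\<close>, and the search starts at a point of attachment. The
  strict majority pays for a starting vertex in either class.\<close>

lemma majority_tail:
  assumes cV: "conn V" and S: "S \<subseteq> V" "S \<noteq> {}"
    and maj: "card ((V - S) \<inter> A) < card ((V - S) \<inter> B)"
  obtains Q p where "is_path (V - S) Q" "p \<in> S" "R p (hd Q)" "last Q \<in> B"
    "nbrs V (last Q) \<subseteq> set Q \<union> S"
proof -
  let ?W = "V - S"
  have "finite ?W" by simp
  from comp_majority[OF this maj]
  obtain v where v: "v \<in> ?W" "card (component ?W v \<inter> A) < card (component ?W v \<inter> B)" .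
  let ?D = "component ?W v"
  obtain p0 where "p0 \<in> S" using S by blast
  then have "reach V v p0" "p0 \<notin> ?W" using cV v S by (auto simp: conn_def)
  then obtain r p where r: "r \<in> ?D" "p \<in> V - ?W" "R r p"
    using reach_exit[OF _ v(1)] by blast
  have DW: "?D \<subseteq> ?W" by (rule comp_subset)
  have eqD: "insert (last [r]) (?D - {r}) = ?D" using r by auto
  have "\<exists>Q'. is_path (V - S) Q' \<and> hd Q' = hd [r] \<and> last Q' \<in> B \<and> nbrs V (last Q') \<subseteq> set Q' \<union> S"
  proof (rule dfs_leaf)
    show "is_path (V - S) [r]" using r DW by (intro is_path_single) auto
    show "?D - {r} \<subseteq> V - S - set [r]" using DW by auto
    show "nbrs V u \<subseteq> ?D - {r} \<union> set [r] \<union> S" if "u \<in> insert (last [r]) (?D - {r})" for u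
    proof
      fix w assume w: "w \<in> nbrs V u"
      have u: "u \<in> ?D" using that eqD by blast
      have "w \<in> ?D" if "w \<notin> S" using comp_nbr[OF u, of w] w that by simp
      then show "w \<in> ?D - {r} \<union> set [r] \<union> S" by auto
    qed
    show "reach (insert (last [r]) (?D - {r})) u (last [r])" if "u \<in> ?D - {r}" for u
      unfolding eqD using conn_comp[OF v(1)] that r by (auto simp: conn_def)
    have f: "finite ?D" using DW by (rule finite_subset) simp
    show "card ((?D - {r}) \<inter> A) + (if last [r] \<in> A then 1 else 0) \<le> card ((?D - {r}) \<inter> B)"
    proof (cases "r \<in> A")
      case True
      then have "(?D - {r}) \<inter> B = ?D \<inter> B" "(?D - {r}) \<inter> A = ?D \<inter> A - {r}"
        using disj by auto
      then show ?thesis using v(2) r True by simp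
    next
      case False
      then have "r \<in> B" using r DW by auto
      have "(?D - {r}) \<inter> B = ?D \<inter> B - {r}" "(?D - {r}) \<inter> A = ?D \<inter> A"
        using False by auto
      then show ?thesis using v(2) r False \<open>r \<in> B\<close> by simp
    qed
  qed
  then show ?thesis using that[of _ p] r by (auto dest: sym)
qed

text \<open>All neighbours are mapped to distinct odd positions of \<open>P\<close>: a neighbour of
  the head keeps its position, a neighbour \<open>P ! j\<close> of \<open>last Q\<close> goes to
  \<open>Suc j\<close>, and a vertex \<open>Q ! m\<close> of \<open>A\<close> goes to
  \<open>i + m + 2\<close>, as if \<open>Q\<close> were laid along \<open>P\<close> behind position
  \<open>i\<close>. Every collision yields a path longer than \<open>P\<close>.\<close>

lemma tail_crossing:
  assumes P: "longest_path V P" and h: "hd P \<in> A"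
    and Q: "is_path (V - set P) Q" and i: "i < length P" "R (P ! i) (hd Q)"
    and z: "last Q \<in> B" "nbrs V (last Q) \<subseteq> set Q \<union> set P"
  shows "card (nbrs V (hd P)) + card (nbrs V (last Q)) \<le> length P div 2"
proof -
  let ?l = "length P" and ?q = "length Q" and ?z = "last Q" and ?x = "hd P"
  have Pp: "is_path V P" using P by (rule longest_is_path)
  have Qp: "is_path V Q" using Q by (rule is_path_subset) auto
  have Qne: "Q \<noteq> []" and PQ: "set P \<inter> set Q = {}" using Q by (auto simp: is_path_def)
  have PtQ: "set (take n P) \<inter> set Q = {}" "set (drop n P) \<inter> set Q = {}" for n
    using PQ set_take_subset[of n P] set_drop_subset[of n P] by auto
  have zV: "?z \<in> V" "?z \<notin> set P" "?z \<in> set Q" using is_path_ends(2,4)[OF Q] by auto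
  have TQ: "is_path V (take (Suc i) P @ Q)" and F1: "i + ?q < ?l"
    using tail_end[OF P Q i] by auto
  have F2: "Suc j < ?l" if "R ?z (P ! j)" "j < ?l" for j
  proof (rule ccontr)
    assume "\<not> Suc j < ?l"
    then have "P ! j = last P" using that by (subst last_conv_nth) (auto intro: arg_cong[of _ _ "(!) P"])
    then show False using longest_last_nbr[OF P] that zV by (auto dest: sym)
  qed
  \<comment> \<open>\<open>Q\<close> ends in \<open>B\<close>, so a vertex of \<open>A\<close> is
    never its last one.\<close>
  have m2: "m + 2 \<le> ?q" if "m < ?q" "Q ! m \<in> A" for m
  proof -
    have "Q ! m \<noteq> ?z" using that z disj by auto
    then have "m \<noteq> ?q - 1" using Qne by (auto simp: last_conv_nth)
    then show ?thesis using that by simp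
  qed
  have F3: False if "Suc j < ?l" "R ?x (P ! Suc j)" "R ?z (P ! j)" for j
  proof -
    have "is_path (V - set P) [?z]" using zV by (intro is_path_single) auto
    from tail_chord[OF P this, of j "Suc j"] that show False by (auto dest: sym)
  qed
  \<comment> \<open>The detour through \<open>Q\<close> would skip only \<open>m + 1\<close>
    vertices of \<open>P\<close>, fewer than \<open>Q\<close> has by \<open>m2\<close>;
    \<open>F5\<close> is the same with \<open>Q\<close> inserted.\<close>
  have F4: False if "m < ?q" "Q ! m \<in> A" "R ?x (P ! (i + m + 2))" for m
    using tail_chord[OF P Q i, of "i + m + 2"] that m2[OF that(1,2)] F1 by simp
  have F5: False if "m < ?q" "Q ! m \<in> A" "R ?z (P ! (i + m + 1))" for m
    using tail_insert[OF P Q i, of "i + m + 1"] that m2[OF that(1,2)] F1 by simp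
  define Ix where "Ix = {j. j < ?l \<and> R ?x (P ! j)}"
  define Iz where "Iz = {j. j < ?l \<and> R ?z (P ! j)}"
  define M where "M = {m. m < ?q \<and> Q ! m \<in> A}"
  define E where "E = (\<lambda>m. i + m + 2) ` M"
  have fin: "finite Ix" "finite Iz" "finite M" "finite E"
    by (auto simp: Ix_def Iz_def M_def E_def)
  have "nbrs V ?x \<subseteq> (!) P ` Ix"
  proof
    fix w assume "w \<in> nbrs V ?x"
    then have "w \<in> set P" "R ?x w" using longest_hd_nbr[OF P] by auto
    then show "w \<in> (!) P ` Ix" by (auto simp: Ix_def in_set_conv_nth)
  qed
  then have cx: "card (nbrs V ?x) \<le> card Ix" using fin(1) by (intro surj_card_le)
  have "nbrs V ?z \<subseteq> (!) Q ` M \<union> (!) P ` Iz"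
  proof
    fix w assume w: "w \<in> nbrs V ?z"
    then have "w \<in> A" using z indepB by auto
    from w z have "w \<in> set Q \<or> w \<in> set P" by blast
    then show "w \<in> (!) Q ` M \<union> (!) P ` Iz"
      using w \<open>w \<in> A\<close> by (auto simp: M_def Iz_def in_set_conv_nth)
  qed
  then have "card (nbrs V ?z) \<le> card ((!) Q ` M \<union> (!) P ` Iz)"
    using fin by (intro card_mono) auto
  also have "\<dots> \<le> card M + card Iz"
    by (rule order_trans[OF card_Un_le]) (use fin in \<open>intro add_mono card_image_le\<close>)
  finally have cz: "card (nbrs V ?z) \<le> card M + card Iz" .
  have cE: "card E = card M" unfolding E_def by (rule card_image) (auto intro: inj_onI)
  have cS: "card (Suc ` Iz) = card Iz" by (rule card_image) auto
  have "Ix \<inter> Suc ` Iz = {}" using F3 by (auto simp: Ix_def Iz_def)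
  moreover have "(Ix \<union> Suc ` Iz) \<inter> E = {}"
    using F4 F5 by (auto simp: Ix_def Iz_def E_def M_def)
  ultimately have "card Ix + card Iz + card M = card (Ix \<union> Suc ` Iz \<union> E)"
    using fin by (simp add: card_Un_disjoint cE cS)
  also have "\<dots> \<le> card {j. j < ?l \<and> odd j}"
  proof (intro card_mono)
    have "odd j" "j < ?l" if "j \<in> Ix" for j
      using that path_parity[OF Pp h, of j] is_path_in[OF Pp, of j] indepA h by (auto simp: Ix_def)
    moreover have "even j" "Suc j < ?l" if "j \<in> Iz" for j
      using that path_parity[OF Pp h, of j] is_path_in[OF Pp, of j] indepB z F2 by (auto simp: Iz_def)
    \<comment> \<open>The parity is read off from the path \<open>take (Suc i) P @ Q\<close>, in
      which \<open>Q ! m\<close> has position \<open>Suc i + m\<close>.\<close>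
    moreover have "odd (i + m)" "i + m + 2 < ?l" if "m \<in> M" for m
    proof -
      show "i + m + 2 < ?l" using that m2[of m] F1 by (simp add: M_def)
      have "hd (take (Suc i) P @ Q) \<in> A" using h i by (auto simp: hd_append hd_take_Suc)
      from path_parity(1)[OF TQ this, of "Suc i + m"] that i
      show "odd (i + m)" by (simp add: M_def nth_append)
    qed
    ultimately show "Ix \<union> Suc ` Iz \<union> E \<subseteq> {j. j < ?l \<and> odd j}"
      by (auto simp: E_def)
  qed simp
  finally show ?thesis using cx cz by (simp add: card_odd_less)
qed

end

section \<open>Removable end vertices of longest paths\<close>

context sym_graph
begin

text \<open>A cycle through all of \<open>P\<close> could be opened at a vertex with a neighbour
  outside, which exists by connectivity, and the path so obtained could be extended.\<close>

lemma longest_no_cycle: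
  assumes P: "longest_path V P" and cV: "conn V" and out: "set P \<noteq> V"
    and C: "is_path V C" "set C = set P" "length C = length P"
  shows "\<not> R (last C) (hd C)"
proof
  assume e: "R (last C) (hd C)"
  have Pp: "is_path V P" using P by (rule longest_is_path)
  obtain w0 where w0: "w0 \<in> V - set P" using Pp out by (auto simp: is_path_def)
  have "reach V w0 (hd P)" "hd P \<notin> V - set P"
    using cV w0 is_path_ends[OF Pp] by (auto simp: conn_def)
  then obtain w u where "w \<in> component (V - set P) w0" "u \<in> V - (V - set P)" "R w u"
    using reach_exit[OF _ w0] by blast
  then have w: "w \<in> V - set P" "u \<in> set P" "R u w"
    using comp_subset[of "V - set P" w0] by (auto dest: sym)
  obtain m where m: "m < length C" "u = C ! m" using w C by (metis in_set_conv_nth)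
  have "is_path V ((drop (Suc m) C @ take (Suc m) C) @ [w])"
  proof (rule is_path_snoc)
    show "is_path V (drop (Suc m) C @ take (Suc m) C)"
    proof (cases "Suc m < length C")
      case True
      have "C \<noteq> []" using m by auto
      then have "R (last (drop (Suc m) C)) (hd (take (Suc m) C))"
        using e True by (simp add: hd_take_Suc)
      then show ?thesis
        using True C disjoint_take_drop[OF C(1), of "Suc m" "Suc m"]
        by (intro is_path_join is_path_take is_path_drop) auto
    qed (use C in simp)
    show "R (last (drop (Suc m) C @ take (Suc m) C)) w"
      using m w by (auto simp: last_append last_take_Suc)
    show "w \<notin> set (drop (Suc m) C @ take (Suc m) C)"
      using w C(2) by (metis DiffE append_take_drop_id set_append Un_commute)
  qed (use w in simp)
  from longestD[OF P this] C m show False by simp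
qed

text \<open>Rotating at the last vertex makes \<open>P ! Suc j\<close> the new end, and its edge to
  the head closes a cycle.\<close>

lemma longest_no_crossing:
  assumes P: "longest_path V P" and cV: "conn V" and out: "set P \<noteq> V"
    and j: "Suc j < length P" "R (hd P) (P ! Suc j)"
  shows "\<not> R (last P) (P ! j)"
proof
  assume e: "R (last P) (P ! j)"
  have Pp: "is_path V P" using P by (rule longest_is_path)
  note rot = is_path_rotate_last[OF Pp j(1) e]
  let ?C = "take (Suc j) P @ rev (drop (Suc j) P)"
  have "R (last ?C) (hd ?C)" unfolding rot(2,3) using j(2) by (rule sym)
  then show False using longest_no_cycle[OF P cV out rot(1,5,4)] by blast
qed

lemma conn_nbr:
  assumes "conn V" "v \<in> V" "w \<in> V" "v \<noteq> w"
  shows "nbrs V v \<noteq> {}"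
proof -
  have "reach V v w" using assms by (simp add: conn_def)
  then show ?thesis using assms(4) unfolding reach_def
    by (cases rule: converse_rtranclpE) auto
qed

lemma conn_remove_hd:
  assumes V: "conn V" and P: "is_path V P" "length P \<ge> 2"
    and nb: "nbrs V (hd P) \<subseteq> set P" and irr: "\<not> R (hd P) (hd P)"
  shows "conn (V - {hd P})"
proof (rule conn_remove[OF V])
  obtain x P' where P': "P = x # P'" "P' \<noteq> []" using P(2) by (cases P; cases "tl P") auto
  then show "conn (set (tl P))" using conn_path[OF is_path_drop[OF P(1), of 1]] P(2) by (simp add: drop_Suc)
  show "set (tl P) \<noteq> {}" "set (tl P) \<subseteq> V - {hd P}"
    using P' P(1) by (auto simp: is_path_def)
  show "nbrs V (hd P) \<subseteq> set (tl P)" using nb irr P' by auto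
qed

end

context bip
begin

lemma path_card:
  assumes P: "is_path V P" and h: "hd P \<in> A"
  shows "card (set P \<inter> B) = length P div 2" and "card (set P \<inter> A) = length P - length P div 2"
proof -
  have "set P \<inter> B = (!) P ` {j. j < length P \<and> odd j}"
    using path_parity(2)[OF P h] by (auto simp: in_set_conv_nth intro!: imageI)
  moreover have "inj_on ((!) P) {j. j < length P \<and> odd j}"
    using P by (auto simp: is_path_def inj_on_def nth_eq_iff_index_eq)
  ultimately show c: "card (set P \<inter> B) = length P div 2"
    by (simp add: card_image card_odd_less)
  have "card (set P \<inter> A) + card (set P \<inter> B) = card (set P)"
    using P disj by (subst card_Un_disjoint[symmetric]) (auto simp: is_path_def intro: arg_cong[of _ _ card])
  also have "\<dots> = length P" using P by (simp add: is_path_def distinct_card)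
  finally show "card (set P \<inter> A) = length P - length P div 2" using c by simp
qed

lemma path_length_parity:
  assumes P: "is_path V P" and h: "hd P \<in> A"
  shows "last P \<in> A \<longleftrightarrow> odd (length P)" "last P \<in> B \<longleftrightarrow> even (length P)"
proof -
  have "P \<noteq> []" using P by (simp add: is_path_def)
  then show "last P \<in> A \<longleftrightarrow> odd (length P)" "last P \<in> B \<longleftrightarrow> even (length P)"
    using path_parity[OF P h, of "length P - 1"] by (auto simp: last_conv_nth)
qed

text \<open>\<open>P\<close> has one more vertex in \<open>A\<close> than in \<open>B\<close>,
  whence the strict majority outside. The deletions keep the graph connected because the neighbours
  of \<open>z\<close> lie on \<open>P\<close> or on the branch before \<open>z\<close>, and those of
  \<open>hd P\<close> lie on \<open>P\<close>, which avoids \<open>z\<close>. The single deletion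
  serves the case of unequal classes, the double one that of equal classes.\<close>

lemma ends_same_pair:
  assumes cV: "conn V" and P: "longest_path V P" and h: "hd P \<in> A" and l: "last P \<in> A"
    and ab: "card A \<le> card B"
  obtains z where "z \<in> B" "z \<notin> set P"
    "card (nbrs B (hd P)) + card (nbrs A z) \<le> length P div 2"
    "conn (V - {z})" "conn (V - {z} - {hd P})"
proof -
  let ?x = "hd P"
  have Pp: "is_path V P" using P by (rule longest_is_path)
  have odd: "odd (length P)" using path_length_parity[OF Pp h] l by simp
  have "(V - set P) \<inter> A = A - (set P \<inter> A)" "(V - set P) \<inter> B = B - (set P \<inter> B)"
    using disj by auto
  moreover have "card (A - (set P \<inter> A)) = card A - card (set P \<inter> A)"
    "card (B - (set P \<inter> B)) = card B - card (set P \<inter> B)"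
    by (auto intro: card_Diff_subset)
  moreover have "card (set P \<inter> A) \<le> card A" "card (set P \<inter> B) \<le> card B"
    by (auto intro: card_mono)
  ultimately have maj: "card ((V - set P) \<inter> A) < card ((V - set P) \<inter> B)"
    using path_card[OF Pp h] odd ab by (auto elim!: oddE)
  have SP: "set P \<subseteq> V" "set P \<noteq> {}" using Pp by (auto simp: is_path_def)
  obtain Q p where Q: "is_path (V - set P) Q" "p \<in> set P" "R p (hd Q)" "last Q \<in> B"
    "nbrs V (last Q) \<subseteq> set Q \<union> set P"
    using majority_tail[OF cV SP maj] by metis
  obtain i where i: "i < length P" "R (P ! i) (hd Q)" using Q by (metis in_set_conv_nth)
  let ?z = "last Q"
  have z: "?z \<in> V" "?z \<notin> set P" "?z \<in> set Q" using is_path_ends[OF Q(1)] by auto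
  have Qne: "Q \<noteq> []" using Q by (simp add: is_path_def)
  have l2: "length P \<ge> 2" using tail_end(2)[OF P Q(1) i] Qne by (cases Q) auto
  have deg: "card (nbrs B ?x) + card (nbrs A ?z) \<le> length P div 2"
    using tail_crossing[OF P h Q(1) i Q(4,5)] nbrs_A[OF h] nbrs_B[OF Q(4)] by simp
  have c1: "conn (V - {?z})"
  proof (rule conn_remove[OF cV])
    let ?C = "set P \<union> set (butlast Q)"
    have dQ: "distinct Q" using Q by (simp add: is_path_def)
    have zb: "?z \<notin> set (butlast Q)"
      using dQ Qne by (metis append_butlast_last_id distinct_append disjoint_iff list.set_intros(1))
    show "conn ?C"
    proof (cases "butlast Q = []")
      case True
      then show ?thesis using conn_path[OF Pp] by simp
    next
      case False
      have lq: "length Q > 1" using False by (cases Q) (auto split: if_splits)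
      have bq: "butlast Q = take (length Q - 1) Q" by (simp add: butlast_conv_take)
      have "is_path (V - set P) (butlast Q)"
        unfolding bq using lq by (intro is_path_take[OF Q(1)]) simp
      moreover have "hd (butlast Q) = hd Q" using False by (metis append_butlast_last_id butlast.simps(1) hd_append2)
      ultimately show ?thesis
        using conn_path[OF Pp] Q(2,3) False
        by (intro conn_union[of _ _ p "hd Q"]) (auto intro: conn_path dest: hd_in_set)
    qed
    show "?C \<noteq> {}" using SP by simp
    show "?C \<subseteq> V - {?z}"
      using SP z zb Q(1) in_set_butlastD[of _ Q] by (auto simp: is_path_def)
    show "nbrs V ?z \<subseteq> ?C"
    proof
      fix w assume w: "w \<in> nbrs V ?z"
      then have "w \<noteq> ?z" using indepB Q(4) by auto
      moreover have "w \<in> set Q \<union> set P" using w Q(5) by blast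
      moreover have "set Q = insert ?z (set (butlast Q))"
        using Qne by (metis append_butlast_last_id Un_insert_right list.set(1,2) set_append sup_bot_right)
      ultimately show "w \<in> ?C" by auto
    qed
  qed
  have c2: "conn (V - {?z} - {?x})"
  proof (rule conn_remove_hd[OF c1 _ l2])
    show "is_path (V - {?z}) P" using Pp z by (auto simp: is_path_def)
    show "nbrs (V - {?z}) ?x \<subseteq> set P" using longest_hd_nbr[OF P] by auto
    show "\<not> R ?x ?x" using h indepA by blast
  qed
  show ?thesis using that[OF Q(4) z(2) deg c1 c2] .
qed

text \<open>Neighbours of the head occupy odd positions and neighbours of the last vertex even ones.
  Shifting the latter by one makes the two sets disjoint, by the ban on crossing chords, within the
  odd positions.\<close>

lemma ends_mixed_pair:
  assumes cV: "conn V" and P: "longest_path V P" and h: "hd P \<in> A" and l: "last P \<in> B"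
    and out: "set P \<noteq> V"
  shows "card (nbrs B (hd P)) + card (nbrs A (last P)) \<le> length P div 2"
    and "\<not> R (hd P) (last P)" and "length P \<ge> 4"
    and "conn (V - {last P})" and "conn (V - {last P} - {hd P})"
proof -
  let ?x = "hd P" and ?y = "last P" and ?l = "length P"
  have Pp: "is_path V P" using P by (rule longest_is_path)
  have ne: "P \<noteq> []" using Pp by (simp add: is_path_def)
  have even: "even ?l" using path_length_parity[OF Pp h] l by simp
  have nox: "\<not> R (hd P) (P ! Suc j) \<or> \<not> R (last P) (P ! j)" if "Suc j < ?l" for j
    using longest_no_crossing[OF P cV out that] by blast
  have l2: "?l \<ge> 2" using even ne by (cases "length P") (auto simp: odd_pos Suc_le_eq)
  have "R (P ! 0) (P ! Suc 0)" using is_path_nth[OF Pp, of 0] l2 by simp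
  then have xy: "\<not> R ?y ?x" using nox[of 0] l2 ne by (simp add: hd_conv_nth)
  then show "\<not> R ?x ?y" by (auto dest: sym)
  have "?l \<noteq> 2"
  proof
    assume "?l = 2"
    then show False using xy is_path_nth[OF Pp, of 0] ne by (auto simp: hd_conv_nth last_conv_nth dest: sym)
  qed
  then show l4: "?l \<ge> 4" using l2 even by presburger
  define Ix where "Ix = {j. j < ?l \<and> R ?x (P ! j)}"
  define Iy where "Iy = {j. j < ?l \<and> R ?y (P ! j)}"
  have fin: "finite Ix" "finite Iy" by (auto simp: Ix_def Iy_def)
  have "nbrs B ?x \<subseteq> (!) P ` Ix"
  proof
    fix w assume "w \<in> nbrs B ?x"
    then have "w \<in> set P" "R ?x w" using longest_hd_nbr[OF P] by auto
    then show "w \<in> (!) P ` Ix" by (auto simp: Ix_def in_set_conv_nth)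
  qed
  then have cx: "card (nbrs B ?x) \<le> card Ix" using fin(1) by (intro surj_card_le)
  have "nbrs A ?y \<subseteq> (!) P ` Iy"
  proof
    fix w assume "w \<in> nbrs A ?y"
    then have "w \<in> set P" "R ?y w" using longest_last_nbr[OF P] by auto
    then show "w \<in> (!) P ` Iy" by (auto simp: Iy_def in_set_conv_nth)
  qed
  then have cy: "card (nbrs A ?y) \<le> card Iy" using fin(2) by (intro surj_card_le)
  have px: "odd j" if "j \<in> Ix" for j
    using that path_parity[OF Pp h, of j] is_path_in[OF Pp, of j] indepA h by (auto simp: Ix_def)
  have py: "even j" "Suc j < ?l" if "j \<in> Iy" for j
  proof -
    show e: "even j"
      using that path_parity[OF Pp h, of j] is_path_in[OF Pp, of j] indepB l by (auto simp: Iy_def)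
    have "Suc j \<noteq> ?l" using e even by (metis even_Suc)
    then show "Suc j < ?l" using that by (auto simp: Iy_def)
  qed
  have "card Ix + card Iy = card (Ix \<union> Suc ` Iy)"
    using fin nox by (subst card_Un_disjoint) (auto simp: card_image Ix_def Iy_def)
  also have "\<dots> \<le> card {j. j < ?l \<and> odd j}"
    using px py by (intro card_mono) (auto simp: Ix_def)
  finally show "card (nbrs B ?x) + card (nbrs A ?y) \<le> ?l div 2"
    using cx cy by (simp add: card_odd_less)
  have rv: "hd (rev P) = ?y" using ne by (simp add: hd_rev)
  show c1: "conn (V - {?y})"
  proof (rule conn_remove_hd[OF cV is_path_rev[OF Pp], unfolded rv])
    show "nbrs V ?y \<subseteq> set (rev P)" using longest_last_nbr[OF P] by auto
    show "\<not> R ?y ?y" using l indepB by blast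
  qed (use l2 in simp)
  \<comment> \<open>Once \<open>?y\<close> is gone, the path without its last vertex shows that
    \<open>?x\<close> is not a cut vertex; the bound \<open>l4\<close> keeps it long enough.\<close>
  have bl: "butlast P = take (?l - 1) P" by (simp add: butlast_conv_take)
  have P': "is_path V (butlast P)" unfolding bl using l2 by (intro is_path_take[OF Pp]) simp
  have hb: "hd (butlast P) = ?x"
    using P' ne by (metis append_butlast_last_id hd_append2 is_path_def)
  have yb: "?y \<notin> set (butlast P)"
    using Pp ne unfolding is_path_def by (metis append_butlast_last_id distinct_append disjoint_iff list.set_intros(1))
  have "conn (V - {?y} - {hd (butlast P)})"
  proof (rule conn_remove_hd[OF c1])
    show "is_path (V - {?y}) (butlast P)" using P' yb by (auto simp: is_path_def)
    show "2 \<le> length (butlast P)" using l4 by simp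
    show "nbrs (V - {?y}) (hd (butlast P)) \<subseteq> set (butlast P)"
    proof
      fix w assume w: "w \<in> nbrs (V - {?y}) (hd (butlast P))"
      then have "w \<in> set P" "w \<noteq> ?y" using longest_hd_nbr[OF P, of w] by (auto simp: hb)
      moreover have "set P = insert ?y (set (butlast P))"
        using ne by (metis append_butlast_last_id Un_insert_right list.set(1,2) set_append sup_bot_right)
      ultimately show "w \<in> set (butlast P)" by auto
    qed
    show "\<not> R (hd (butlast P)) (hd (butlast P))" unfolding hb using h indepA by blast
  qed
  then show "conn (V - {?y} - {?x})" by (simp add: hb)
qed

text \<open>The head could see every odd position; the place where an outside vertex is attached to
  \<open>P\<close> blocks one of them. An attached vertex of \<open>B\<close> blocks the next
  position, and one of \<open>A\<close>, continued by a second outside vertex, blocks the position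
  two steps on. It is applied with the classes exchanged, to longest paths with both ends in
  \<open>B\<close>.\<close>

lemma ends_same_deg:
  assumes cV: "conn V" and P: "longest_path V P" and h: "hd P \<in> A" and l: "last P \<in> A"
    and u: "u \<in> B" "u \<notin> set P"
  shows "card (nbrs B (hd P)) < length P div 2" and "conn (V - {hd P})"
proof -
  let ?x = "hd P" and ?l = "length P" and ?W = "V - set P"
  have Pp: "is_path V P" using P by (rule longest_is_path)
  have odd: "odd ?l" using path_length_parity[OF Pp h] l by simp
  have uW: "u \<in> ?W" using u by auto
  have "reach V u ?x" "?x \<notin> ?W"
    using cV uW is_path_ends[OF Pp] by (auto simp: conn_def)
  then obtain r p where r: "r \<in> component ?W u" "p \<in> V - ?W" "R r p"
    using reach_exit[OF _ uW] by blast
  obtain i where i: "i < ?l" "R (P ! i) r" using r by (auto simp: in_set_conv_nth dest: sym)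
  have rW: "r \<in> ?W" using r comp_subset by blast
  have rP: "is_path ?W [r]" using rW by (rule is_path_single)
  have l2: "?l \<ge> 2" using tail_end(2)[OF P rP i(1)] i by simp
  show "conn (V - {?x})"
  proof (rule conn_remove_hd[OF cV Pp l2])
    show "nbrs V ?x \<subseteq> set P" using longest_hd_nbr[OF P] by auto
    show "\<not> R ?x ?x" using h indepA by blast
  qed
  define Ix where "Ix = {j. j < ?l \<and> R ?x (P ! j)}"
  have fin: "finite Ix" by (auto simp: Ix_def)
  have "nbrs B ?x \<subseteq> (!) P ` Ix"
  proof
    fix w assume "w \<in> nbrs B ?x"
    then have "w \<in> set P" "R ?x w" using longest_hd_nbr[OF P] by auto
    then show "w \<in> (!) P ` Ix" by (auto simp: Ix_def in_set_conv_nth)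
  qed
  then have cx: "card (nbrs B ?x) \<le> card Ix" using fin by (intro surj_card_le)
  have px: "odd j" if "j \<in> Ix" for j
    using that path_parity[OF Pp h, of j] is_path_in[OF Pp, of j] indepA h by (auto simp: Ix_def)
  have "\<exists>j. j < ?l \<and> odd j \<and> j \<notin> Ix"
  proof (cases "r \<in> B")
    case True
    then have "even i" using path_parity[OF Pp h, of i] is_path_in[OF Pp, of i] indepB i by auto
    moreover have "Suc i < ?l" using tail_end(2)[OF P rP] i by simp
    moreover have "\<not> R ?x (P ! Suc i)" using tail_chord[OF P rP, of i "Suc i"] i calculation by auto
    ultimately show ?thesis by (intro exI[of _ "Suc i"]) (auto simp: Ix_def)
  next
    case False
    then have rA: "r \<in> A" using rW by auto
    then have oi: "odd i" using path_parity[OF Pp h, of i] is_path_in[OF Pp, of i] indepA i by auto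
    have "r \<noteq> u" using rA u disj by auto
    moreover have "reach ?W u r" using r by (simp add: component_def)
    \<comment> \<open>The last step of a walk from \<open>u\<close> to \<open>r\<close> outside
      \<open>P\<close> supplies the second outside vertex.\<close>
    ultimately have "\<exists>r'\<in>?W. R r' r"
      unfolding reach_def by (metis (no_types, lifting) rtranclp.cases)
    then obtain r' where r': "r' \<in> ?W" "R r r'" by (auto dest: sym)
    have "r' \<noteq> r" using r' rA indepA by auto
    then have Q: "is_path ?W [r, r']" using r' rW by (simp add: is_path_def)
    have i2: "i + 2 < ?l" using tail_end(2)[OF P Q] i by simp
    have "\<not> R ?x (P ! (i + 2))" using tail_chord[OF P Q, of i "i + 2"] i i2 by auto
    then show ?thesis using i2 oi by (intro exI[of _ "i + 2"]) (auto simp: Ix_def)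
  qed
  then have "Ix \<subset> {j. j < ?l \<and> odd j}" using px by (auto simp: Ix_def)
  then have "card Ix < card {j. j < ?l \<and> odd j}" by (intro psubset_card_mono) auto
  then show "card (nbrs B ?x) < ?l div 2" using cx by (simp add: card_odd_less)
qed

end

section \<open>Long paths around a complete bipartite subgraph\<close>

context sym_graph
begin

definition edge_count :: "'a set \<Rightarrow> 'a set \<Rightarrow> nat" where
  "edge_count X Y = (\<Sum>x\<in>X. card (nbrs Y x))"

text \<open>The extremal family for even \<open>k\<close>, described inside the graph instead of up
  to isomorphism: \<open>T\<close> and \<open>Y\<close> span the \<open>K_{t,b}\<close>, and
  \<open>X - T\<close> holds the pendant vertices.\<close>

definition pendant_structure :: "nat \<Rightarrow> 'a set \<Rightarrow> 'a set \<Rightarrow> bool" where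
  "pendant_structure t X Y \<longleftrightarrow>
     (\<exists>T\<subseteq>X. card T = t \<and> (\<forall>x\<in>T. \<forall>y\<in>Y. R x y) \<and> (\<forall>x\<in>X - T. card (nbrs Y x) = 1))"

lemma edge_count_swap:
  assumes "finite X" "finite Y"
  shows "edge_count X Y = edge_count Y X"
proof -
  have c: "card (nbrs Z v) = (\<Sum>u\<in>Z. if R v u then 1 else 0)" if "finite Z" for Z v
    using that by (simp add: nbrs_def sum.If_cases Int_def)
  have "R u v \<longleftrightarrow> R v u" for u v using sym by blast
  then show ?thesis
    unfolding edge_count_def c[OF assms(1)] c[OF assms(2)] by (subst sum.swap) simp
qed

lemma edge_count_remove_left:
  "finite X \<Longrightarrow> x \<in> X \<Longrightarrow> edge_count X Y = card (nbrs Y x) + edge_count (X - {x}) Y"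
  unfolding edge_count_def by (rule sum.remove)

lemma edge_count_remove_right:
  assumes "finite X" "finite Y" "y \<in> Y"
  shows "edge_count X Y = card (nbrs X y) + edge_count X (Y - {y})"
  using edge_count_remove_left[OF assms(2,3), of X] assms edge_count_swap by simp

text \<open>The path follows \<open>Q1\<close>, enters \<open>T\<close> at \<open>v\<close>,
  alternates between \<open>T\<close> and \<open>Z\<close> until \<open>T\<close> is exhausted, and
  leaves along \<open>Q2\<close>. As \<open>Q2\<close> brings its own first vertex in
  \<open>Z\<close>, just \<open>card T - 1\<close> fresh vertices of \<open>Z\<close> are
  used.\<close>

lemma zigzag_path:
  assumes "finite T" "finite Z" "T \<subseteq> V" "Z \<subseteq> V" "T \<inter> Z = {}" and "\<And>x y. x \<in> T \<Longrightarrow> y \<in> Z \<Longrightarrow> R x y"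
    and "v \<in> T" "is_path V Q1" "R (last Q1) v" "set Q1 \<inter> T = {}"
    and "is_path V Q2" "hd Q2 \<in> Z" "set Q2 \<inter> T = {}" "set Q1 \<inter> set Q2 = {}"
    and "card T \<le> card (Z - set Q1 - set Q2) + 1"
  shows "\<exists>M. is_path V M \<and> length M + 1 = length Q1 + length Q2 + 2 * card T"
  using assms
proof (induction "card T" arbitrary: T Q2 rule: less_induct)
  case less
  note fT = less.prems(1) and TV = less.prems(3) and TZ = less.prems(5) and e = less.prems(6)
    and v = less.prems(7) and Q1 = less.prems(8-10) and Q2 = less.prems(11-14) and c = less.prems(15)
  show ?case
  proof (cases "T = {v}")
    case True
    have "is_path V (Q1 @ ([v] @ Q2))"
      using Q1 Q2 v TV e True by (intro is_path_join is_path_single) auto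
    then show ?thesis using True by (intro exI[of _ "Q1 @ ([v] @ Q2)"]) simp
  next
    case False
    then obtain w where w: "w \<in> T" "w \<noteq> v" using v by blast
    have cT: "card (T - {w}) + 1 = card T" using card_Suc_Diff1[OF fT w(1)] by simp
    have "v \<in> T - {w}" using w v by auto
    then have "card (T - {w}) > 0" using fT by (metis card_gt_0_iff empty_iff finite_Diff)
    then have "card (Z - set Q1 - set Q2) > 0" using c cT by linarith
    then obtain b where b: "b \<in> Z - set Q1 - set Q2" by (auto simp: card_gt_0_iff)
    \<comment> \<open>\<open>Q2\<close> grows at its front by one vertex of each side, so its head
      stays in \<open>Z\<close>.\<close>
    let ?Q = "[b] @ [w] @ Q2"
    have "is_path V ([w] @ Q2)"
      using w Q2 e TV by (intro is_path_join is_path_single) auto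
    moreover have "R b w" using b w e by (auto intro: sym)
    ultimately have "is_path V ?Q"
      using b w Q2 TZ less.prems(4) by (intro is_path_join[of _ "[b]"] is_path_single) auto
    moreover have "Z - set Q1 - set ?Q = (Z - set Q1 - set Q2) - {b}"
      using w TZ by auto
    then have "card (Z - set Q1 - set ?Q) + 1 = card (Z - set Q1 - set Q2)"
      using card_Suc_Diff1[OF _ b] less.prems(2) by simp
    moreover have "card (T - {w}) < card T" using cT by simp
    moreover have "set ?Q \<inter> (T - {w}) = {}" using Q2 b TZ by auto
    moreover have "set Q1 \<inter> set ?Q = {}" using Q1 Q2 b w by auto
    ultimately have "\<exists>M. is_path V M \<and> length M + 1 = length Q1 + length ?Q + 2 * card (T - {w})"
      using less.prems b w Q1 cT by (intro less.hyps) auto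
    then show ?thesis using cT by auto
  qed
qed

end

context bip
begin

text \<open>Besides all of \<open>T\<close> the path contains \<open>x\<close>, threaded between
  \<open>y1\<close> and \<open>y2\<close>, and \<open>w\<close> at an end: next to the shared
  neighbour, or via \<open>y\<close> at the other end of the zigzag. The end pieces use at most
  three vertices of \<open>B\<close>, leaving the \<open>card T - 1\<close> that the zigzag
  needs.\<close>

lemma long_path_two_nbrs:
  assumes T: "T \<subseteq> A" "T \<noteq> {}" "\<And>x y. x \<in> T \<Longrightarrow> y \<in> B \<Longrightarrow> R x y"
    and b: "card T + 2 \<le> card B"
    and x: "x \<in> A - T" "y1 \<in> B" "y2 \<in> B" "y1 \<noteq> y2" "R x y1" "R x y2"
    and w: "w \<in> A - T" "w \<noteq> x" "y \<in> B" "R w y"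
  shows "\<exists>M. is_path V M \<and> length M = 2 * card T + 4"
proof -
  obtain v where v: "v \<in> T" using T by blast
  have fT: "finite T" using T(1) finA by (rule finite_subset)
  have ine: "a \<noteq> c" "c \<noteq> a" if "a \<in> A" "c \<in> B" for a c using that disj by auto
  have zig: "\<exists>M. is_path V M \<and> length M + 1 = length Q1 + length Q2 + 2 * card T"
    if "is_path V Q1" "last Q1 \<in> B" "set Q1 \<inter> T = {}" "is_path V Q2" "hd Q2 \<in> B"
      "set Q2 \<inter> T = {}" "set Q1 \<inter> set Q2 = {}" "card ((set Q1 \<union> set Q2) \<inter> B) \<le> 3" for Q1 Q2
  proof -
    have "card B - card ((set Q1 \<union> set Q2) \<inter> B) \<le> card (B - (set Q1 \<union> set Q2) \<inter> B)"
      by (rule diff_card_le_card_Diff) simp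
    moreover have "B - (set Q1 \<union> set Q2) \<inter> B = B - set Q1 - set Q2" by auto
    ultimately have "card T \<le> card (B - set Q1 - set Q2) + 1" using b that(8) by simp
    then show ?thesis
      using that v T fT disj by (intro zigzag_path[of T B V v]) (auto intro: sym)
  qed
  have two: ?thesis if y12: "y1 \<in> B" "y2 \<in> B" "y1 \<noteq> y2" "R x y1" "R x y2" "y = y1" for y1 y2
  proof -
    have "\<not> B \<subseteq> {y1, y2}"
    proof
      assume "B \<subseteq> {y1, y2}"
      then have "card B \<le> card {y1, y2}" by (intro card_mono) auto
      moreover have "card T > 0" using T(2) fT by (simp add: card_gt_0_iff)
      ultimately show False using b y12 by simp
    qed
    then obtain b' where b': "b' \<in> B" "b' \<noteq> y1" "b' \<noteq> y2" by blast
    have "card ((set [w, y1, x, y2] \<union> set [b']) \<inter> B) \<le> card {y1, y2, b'}"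
      using x w disj by (intro card_mono) auto
    also have "\<dots> \<le> 3" by (simp add: card_insert_if)
    finally have "\<exists>M. is_path V M \<and> length M + 1 = length [w, y1, x, y2] + length [b'] + 2 * card T"
      using x w y12 b' T ine disj
      by (intro zig) (auto simp: is_path_def intro: sym)
    then show ?thesis by auto
  qed
  consider "y = y1" | "y = y2" | "y \<noteq> y1" "y \<noteq> y2" by blast
  then show ?thesis
  proof cases
    case 1 then show ?thesis using two[of y1 y2] x by auto
  next
    case 2 then show ?thesis using two[of y2 y1] x by auto
  next
    case 3
    have "card ((set [y1, x, y2] \<union> set [y, w]) \<inter> B) \<le> card {y1, y2, y}"
      using x w disj by (intro card_mono) auto
    also have "\<dots> \<le> 3" by (simp add: card_insert_if)
    finally have "\<exists>M. is_path V M \<and> length M + 1 = length [y1, x, y2] + length [y, w] + 2 * card T"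
      using x w 3 T ine disj
      by (intro zig) (auto simp: is_path_def intro: sym)
    then show ?thesis by auto
  qed
qed

text \<open>A neighbour of \<open>z\<close> outside \<open>T\<close> would let a path use
  \<open>z\<close> and two vertices of \<open>A - T\<close> together with all of \<open>T\<close>,
  which makes \<open>2 * card T + 4\<close> vertices. So \<open>nbrs A z\<close> lies in
  \<open>T\<close>, and the cardinalities agree.\<close>

lemma new_vertex_nbrs:
  assumes T: "T \<subseteq> A" "\<And>x y. x \<in> T \<Longrightarrow> y \<in> B - {z} \<Longrightarrow> R x y" and t: "card T \<ge> 2"
    and b: "card T + 2 \<le> card (B - {z})" and z: "z \<in> B" "card (nbrs A z) = card T"
    and p: "card (A - T) \<ge> 2" "\<And>x. x \<in> A - T \<Longrightarrow> nbrs (B - {z}) x \<noteq> {}"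
    and free: "\<And>M. is_path V M \<Longrightarrow> length M \<noteq> 2 * card T + 4"
  shows "nbrs A z = T"
proof -
  let ?Z = "B - {z}"
  have fT: "finite T" using T(1) finA by (rule finite_subset)
  have ine: "a \<noteq> c" "c \<noteq> a" if "a \<in> A" "c \<in> B" for a c using that disj by auto
  have zig: "\<exists>M. is_path V M \<and> length M + 1 = length Q1 + length Q2 + 2 * card T"
    if "v \<in> T" "is_path V Q1" "R (last Q1) v" "set Q1 \<inter> T = {}" "is_path V Q2" "hd Q2 \<in> ?Z"
      "set Q2 \<inter> T = {}" "set Q1 \<inter> set Q2 = {}" "card ((set Q1 \<union> set Q2) \<inter> ?Z) \<le> 3" for v Q1 Q2
  proof -
    have "card ?Z - card ((set Q1 \<union> set Q2) \<inter> ?Z) \<le> card (?Z - (set Q1 \<union> set Q2) \<inter> ?Z)"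
      by (rule diff_card_le_card_Diff) simp
    moreover have "?Z - (set Q1 \<union> set Q2) \<inter> ?Z = ?Z - set Q1 - set Q2" by auto
    ultimately have "card T \<le> card (?Z - set Q1 - set Q2) + 1" using b that(9) by simp
    then show ?thesis
      using that T fT disj by (intro zigzag_path[of T ?Z V v]) (auto intro: sym)
  qed
  have avoid: "\<exists>b'. b' \<in> ?Z \<and> b' \<noteq> c" for c
  proof (rule ccontr)
    assume "\<not> ?thesis"
    then have "?Z \<subseteq> {c}" by auto
    then have "card ?Z \<le> card {c}" by (intro card_mono) auto
    then show False using b t by simp
  qed
  have "nbrs A z \<subseteq> T"
  proof (rule ccontr)
    assume "\<not> nbrs A z \<subseteq> T"
    then have "\<exists>u\<in>A - T. R z u" by auto
    then obtain u where u: "u \<in> A - T" "R z u" "R u z" using sym by blast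
    have nb: "\<exists>y\<in>?Z. R x y \<and> R y x" if "x \<in> A - T" for x
    proof -
      have "nbrs ?Z x \<noteq> {}" using that by (rule p(2))
      then obtain y where "y \<in> ?Z" "R x y" by (metis nbrs_iff ex_in_conv)
      then show ?thesis using sym by blast
    qed
    obtain y where y: "y \<in> ?Z" "R u y" "R y u" using nb[OF u(1)] by blast
    \<comment> \<open>If \<open>z\<close> has no neighbour in \<open>T\<close>, its degree of at
      least 2 gives a second neighbour \<open>u'\<close> outside \<open>T\<close>, and
      \<open>z\<close> joins \<open>u'\<close> to \<open>u\<close>. Otherwise \<open>z\<close> joins
      \<open>u\<close> to a vertex of \<open>T\<close>, and a second vertex \<open>w\<close> of
      \<open>A - T\<close> supplies the missing length.\<close>
    show False
    proof (cases "nbrs A z \<inter> T = {}")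
      case True
      have "nbrs A z \<noteq> {u}" using z t by auto
      moreover have "u \<in> nbrs A z" using u by simp
      ultimately have "\<exists>u'\<in>nbrs A z. u' \<noteq> u" by blast
      then have "\<exists>u'\<in>A. R z u' \<and> u' \<noteq> u" by (auto simp: nbrs_def)
      then obtain u' where u': "u' \<in> A" "R z u'" "R u' z" "u' \<noteq> u" using sym by blast
      have "u' \<notin> T" using u' True by auto
      obtain v where v: "v \<in> T" using t by fastforce
      have Ryv: "R y v" using T v y by (auto intro: sym)
      obtain b' where b': "b' \<in> ?Z" "b' \<noteq> y" using avoid by blast
      have "card ((set [u', z, u, y] \<union> set [b']) \<inter> ?Z) \<le> card {y, b'}"
        using u u' disj by (intro card_mono) auto
      also have "\<dots> \<le> 3" by (simp add: card_insert_if)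
      finally have "\<exists>M. is_path V M \<and> length M + 1 = length [u', z, u, y] + length [b'] + 2 * card T"
        using u u' \<open>u' \<notin> T\<close> y b' z T ine disj Ryv
        by (intro zig[OF v]) (auto simp: is_path_def)
      then have "\<exists>M. is_path V M \<and> length M = 2 * card T + 4" by auto
      then show False using free by blast
    next
      case False
      then obtain v where v: "v \<in> T" "R z v" by auto
      have "A - T \<noteq> {u}" using p(1) by auto
      then obtain w where w: "w \<in> A - T" "w \<noteq> u" using u by blast
      obtain yw where yw: "yw \<in> ?Z" "R w yw" "R yw w" using nb[OF w(1)] by blast
      show False
      proof (cases "yw = y")
        case True
        obtain b' where b': "b' \<in> ?Z" "b' \<noteq> y" using avoid by blast
        have "card ((set [w, y, u, z] \<union> set [b']) \<inter> ?Z) \<le> card {y, b'}"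
          using u w disj by (intro card_mono) auto
        also have "\<dots> \<le> 3" by (simp add: card_insert_if)
        finally have "\<exists>M. is_path V M \<and> length M + 1 = length [w, y, u, z] + length [b'] + 2 * card T"
          using u y b' z w yw True T ine disj v
          by (intro zig[OF v(1)]) (auto simp: is_path_def)
        then have "\<exists>M. is_path V M \<and> length M = 2 * card T + 4" by auto
      then show False using free by blast
      next
        case False
        have "card ((set [y, u, z] \<union> set [yw, w]) \<inter> ?Z) \<le> card {y, yw}"
          using u w disj by (intro card_mono) auto
        also have "\<dots> \<le> 3" by (simp add: card_insert_if)
        finally have "\<exists>M. is_path V M \<and> length M + 1 = length [y, u, z] + length [yw, w] + 2 * card T"
          using u y z w yw False T ine disj v
          by (intro zig[OF v(1)]) (auto simp: is_path_def)
        then have "\<exists>M. is_path V M \<and> length M = 2 * card T + 4" by auto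
      then show False using free by blast
      qed
    qed
  qed
  then show ?thesis using fT z by (intro card_subset_eq) auto
qed

end

section \<open>The square case\<close>

context sym_graph
begin

text \<open>The longer path is \<open>z\<close>, positions \<open>j\<close> down to 0, the chord to
  \<open>j + 3\<close>, on to the end, the chord back to \<open>j + 1\<close>, and finally
  \<open>j + 2\<close>: all of \<open>P\<close> and \<open>z\<close>.\<close>

lemma longest_detour:
  assumes P: "longest_path V P" and z: "z \<in> V" "z \<notin> set P" "R (P ! j) z"
    and j: "j + 3 < length P" "R (hd P) (P ! (j + 3))" "R (last P) (P ! (j + 1))"
  shows False
proof -
  have Pp: "is_path V P" using P by (rule longest_is_path)
  have zP: "is_path (V - set P) [z]" using z by (intro is_path_single) auto
  have TQ: "is_path V (take (Suc j) P @ [z])"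
    using tail_end(1)[OF P zP, of j] z j by simp
  have "last (rev (take (Suc j) P @ [z])) = hd P"
    using Pp by (subst last_rev) (auto simp: hd_append hd_take_Suc is_path_def)
  moreover have "set (take (Suc j) P @ [z]) \<inter> set (drop (j + 3) P) = {}"
    using disjoint_take_drop[OF Pp, of "Suc j" "j + 3"] z set_drop_subset[of "j + 3" P] by auto
  ultimately have 1: "is_path V (rev (take (Suc j) P @ [z]) @ drop (j + 3) P)"
    using j by (intro is_path_join[OF is_path_rev[OF TQ] is_path_drop[OF Pp]])
      (auto simp: hd_drop_conv_nth simp del: rev_append)
  let ?M = "take 2 (drop (Suc j) P)"
  have eq: "take (j + 3) P = take (Suc j) P @ ?M" by (simp add: take_add[symmetric] eval_nat_numeral)
  have dT: "distinct (take (j + 3) P)" using Pp by (simp add: is_path_def)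
  have "set (take (Suc j) P) \<inter> set ?M = {}" using dT unfolding eq distinct_append by blast
  moreover have "set ?M \<inter> set (drop (j + 3) P) = {}"
    using disjoint_take_drop[OF Pp, of "j + 3" "j + 3"] unfolding eq by auto
  moreover have "z \<notin> set ?M" using z by (auto dest: in_set_takeD in_set_dropD)
  ultimately have "set (rev (take (Suc j) P @ [z]) @ drop (j + 3) P) \<inter> set ?M = {}" by auto
  moreover have "is_path V ?M" using j by (intro is_path_take is_path_drop[OF Pp]) auto
  moreover have "hd ?M = P ! (j + 1)" using j by (simp add: hd_drop_conv_nth)
  ultimately have "is_path V ((rev (take (Suc j) P @ [z]) @ drop (j + 3) P) @ ?M)"
    using j by (intro is_path_join[OF 1]) (auto simp del: rev_append)
  from longestD[OF P this] j show False by simp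
qed

section \<open>Counting edges between two vertex sets\<close>

lemma edge_count_compl:
  assumes "finite X" "finite Y"
  shows "edge_count X Y + card {(u, v) \<in> X \<times> Y. \<not> R u v} = card X * card Y"
proof -
  have "edge_count X Y = card (SIGMA u:X. nbrs Y u)"
    unfolding edge_count_def using assms by simp
  also have "(SIGMA u:X. nbrs Y u) = {(u, v) \<in> X \<times> Y. R u v}" by auto
  finally have "edge_count X Y + card {(u, v) \<in> X \<times> Y. \<not> R u v}
    = card ({(u, v) \<in> X \<times> Y. R u v} \<union> {(u, v) \<in> X \<times> Y. \<not> R u v})"
    using assms by (subst card_Un_disjoint) (auto intro: finite_subset[of _ "X \<times> Y"])
  also have "{(u, v) \<in> X \<times> Y. R u v} \<union> {(u, v) \<in> X \<times> Y. \<not> R u v} = X \<times> Y" by auto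
  finally show ?thesis by (simp add: card_cartesian_product)
qed

lemma edge_count_split_right:
  assumes "finite X" "finite Y" "Z \<subseteq> Y"
  shows "edge_count X Y = edge_count X Z + edge_count X (Y - Z)"
proof -
  have "card (nbrs Y x) = card (nbrs Z x) + card (nbrs (Y - Z) x)" for x
    using assms finite_subset[OF assms(3)]
    by (subst card_Un_disjoint[symmetric]) (auto intro: arg_cong[of _ _ card] simp: nbrs_def)
  then show ?thesis by (simp add: edge_count_def sum.distrib)
qed

lemma edge_count_split_left:
  assumes "finite X" "finite Y" "Z \<subseteq> X"
  shows "edge_count X Y = edge_count Z Y + edge_count (X - Z) Y"
  unfolding edge_count_def using sum.subset_diff[OF assms(3,1)] by (simp add: add.commute)

lemma edge_count_le:
  assumes "\<And>x. x \<in> X \<Longrightarrow> card (nbrs Y x) \<le> d"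
  shows "edge_count X Y \<le> card X * d"
  unfolding edge_count_def using sum_bounded_above[OF assms] by simp

lemma edge_count_tight:
  assumes "finite X" "\<And>x. x \<in> X \<Longrightarrow> card (nbrs Y x) \<le> d" "edge_count X Y = card X * d" "x \<in> X"
  shows "card (nbrs Y x) = d"
  using sum_mono_inv[of "\<lambda>x. card (nbrs Y x)" X "\<lambda>_. d" x] assms by (simp add: edge_count_def)

lemma nbrs_full: "finite Y \<Longrightarrow> card (nbrs Y x) = card Y \<Longrightarrow> y \<in> Y \<Longrightarrow> R x y"
  using card_subset_eq[of Y "nbrs Y x"] by (auto simp: nbrs_def)

end

context bip
begin

text \<open>\<open>J\<close> holds the positions of the vertices that become the head after one
  rotation; there are as many of them as the head has neighbours.\<close>

lemma hd_shift:
  assumes P: "longest_path V P" and h: "hd P \<in> A"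
  defines "J \<equiv> {j. Suc j < length P \<and> R (hd P) (P ! Suc j)}"
  shows "card J = card (nbrs B (hd P))" and "j \<in> J \<Longrightarrow> P ! j \<in> A" and "finite J"
proof -
  have Pp: "is_path V P" using P by (rule longest_is_path)
  have d: "distinct P" and ne: "P \<noteq> []" using Pp by (auto simp: is_path_def)
  have B: "P ! Suc j \<in> B" if "j \<in> J" for j
    using that h indepA is_path_in[OF Pp, of "Suc j"] by (auto simp: J_def)
  have "nbrs B (hd P) = (\<lambda>j. P ! Suc j) ` J"
  proof
    show "(\<lambda>j. P ! Suc j) ` J \<subseteq> nbrs B (hd P)" using B by (auto simp: J_def)
    show "nbrs B (hd P) \<subseteq> (\<lambda>j. P ! Suc j) ` J"
    proof
      fix w assume w: "w \<in> nbrs B (hd P)"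
      then have "w \<in> set P" using longest_hd_nbr[OF P] by auto
      then obtain m where m: "m < length P" "w = P ! m" by (auto simp: in_set_conv_nth)
      have "m \<noteq> 0" using m w h disj ne by (auto simp: hd_conv_nth)
      then obtain j where "m = Suc j" by (cases m) auto
      then show "w \<in> (\<lambda>j. P ! Suc j) ` J" using m w by (auto simp: J_def)
    qed
  qed
  moreover have "inj_on (\<lambda>j. P ! Suc j) J"
    using d by (auto simp: inj_on_def J_def nth_eq_iff_index_eq)
  ultimately show "card J = card (nbrs B (hd P))" by (simp add: card_image)
  show "P ! j \<in> A" if "j \<in> J"
    using B[OF that] that path_parity[OF Pp h, of j] path_parity[OF Pp h, of "Suc j"]
    by (auto simp: J_def)
  show "finite J" unfolding J_def by (rule finite_subset[of _ "{..<length P}"]) auto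
qed

lemma last_shift:
  assumes P: "longest_path V P" and h: "hd P \<in> A" and l: "last P \<in> B"
  defines "K \<equiv> {j. Suc j < length P \<and> R (last P) (P ! j)}"
  shows "card K = card (nbrs A (last P))" and "j \<in> K \<Longrightarrow> P ! Suc j \<in> B" and "finite K"
proof -
  have Pp: "is_path V P" using P by (rule longest_is_path)
  have d: "distinct P" and ne: "P \<noteq> []" using Pp by (auto simp: is_path_def)
  have A: "P ! j \<in> A" if "j \<in> K" for j
    using that l indepB is_path_in[OF Pp, of j] by (auto simp: K_def)
  have "nbrs A (last P) = (\<lambda>j. P ! j) ` K"
  proof
    show "(\<lambda>j. P ! j) ` K \<subseteq> nbrs A (last P)" using A by (auto simp: K_def)
    show "nbrs A (last P) \<subseteq> (\<lambda>j. P ! j) ` K"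
    proof
      fix w assume w: "w \<in> nbrs A (last P)"
      then have "w \<in> set P" using longest_last_nbr[OF P] by auto
      then obtain m where m: "m < length P" "w = P ! m" by (auto simp: in_set_conv_nth)
      have "m \<noteq> length P - 1" using m w l disj ne by (auto simp: last_conv_nth)
      then show "w \<in> (\<lambda>j. P ! j) ` K" using m w by (auto simp: K_def)
    qed
  qed
  moreover have "inj_on (\<lambda>j. P ! j) K"
    using d by (auto simp: inj_on_def K_def nth_eq_iff_index_eq)
  ultimately show "card K = card (nbrs A (last P))" by (simp add: card_image)
  show "P ! Suc j \<in> B" if "j \<in> K"
    using A[OF that] that path_parity[OF Pp h, of j] path_parity[OF Pp h, of "Suc j"]
    by (auto simp: K_def)
  show "finite K" unfolding K_def by (rule finite_subset[of _ "{..<length P}"]) auto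
qed

text \<open>With \<open>d\<close> the largest degree of a head, \<open>d + 1\<close> vertices of
  \<open>A\<close> have degree at most \<open>d\<close>, and the others at most \<open>s\<close>. A
  vertex outside \<open>P\<close> of positive degree forces \<open>d + 2 \<le> s\<close>, which
  makes this estimate sufficient.\<close>

lemma square_case_same_ends:
  assumes cV: "conn V" and a: "card A = s" and b: "card B = s" and s: "4 \<le> s"
    and free: "\<And>xs. is_path V xs \<Longrightarrow> length xs < 2 * s"
    and ex: "longest_path V P0" "hd P0 \<in> A" "last P0 \<in> A"
  shows "edge_count A B + 2 * s \<le> s * s + 2"
    and "edge_count A B + 2 * s = s * s + 2 \<Longrightarrow> pendant_structure (s - 2) A B"
proof -
  let ?good = "\<lambda>P. longest_path V P \<and> hd P \<in> A \<and> last P \<in> A"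
  have "\<exists>P. ?good P \<and> (\<forall>P'. ?good P' \<longrightarrow> card (nbrs B (hd P')) \<le> card (nbrs B (hd P)))"
  proof (rule ex_has_greatest_nat)
    show "?good P0" using ex by blast
    show "\<forall>P'. ?good P' \<longrightarrow> card (nbrs B (hd P')) < Suc (card B)"
      by (auto simp: less_Suc_eq_le nbrs_def intro!: card_mono)
  qed
  then obtain P where P: "longest_path V P" and h: "hd P \<in> A" and la: "last P \<in> A"
    and mx: "\<And>P'. ?good P' \<Longrightarrow> card (nbrs B (hd P')) \<le> card (nbrs B (hd P))" by blast
  let ?x = "hd P" and ?y = "last P" and ?l = "length P"
  define d where "d = card (nbrs B ?x)"
  have Pp: "is_path V P" using P by (rule longest_is_path)
  have dP: "distinct P" and ne: "P \<noteq> []" using Pp by (auto simp: is_path_def)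
  have l: "odd ?l" "?l < 2 * s" using path_length_parity[OF Pp h] la free[OF Pp] by auto
  obtain z where z: "z \<in> B" "z \<notin> set P" "d + card (nbrs A z) \<le> ?l div 2"
    using ends_same_pair[OF cV P h la] a b unfolding d_def by (metis order_refl)
  have xz: "?x \<noteq> z" using h z disj by auto
  have dz: "card (nbrs A z) \<ge> 1"
    using conn_nbr[OF cV, of z ?x] z h xz nbrs_B[OF z(1)] by (simp add: Suc_le_eq card_gt_0_iff)
  have dx: "d \<ge> 1"
    using conn_nbr[OF cV, of ?x z] z h xz nbrs_A[OF h] unfolding d_def by (simp add: Suc_le_eq card_gt_0_iff)
  have ds: "d + 2 \<le> s" using z dz l by linarith
  define J where "J = {j. Suc j < ?l \<and> R ?x (P ! Suc j)}"
  note J = hd_shift[OF P h, folded J_def]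
  \<comment> \<open>The rotated heads together with the other end of \<open>P\<close>, which becomes
    a head by reversal. All of them are heads of longest paths with both ends in \<open>A\<close>,
    so their degrees are at most \<open>d\<close>.\<close>
  define F where "F = (!) P ` insert (?l - 1) J"
  have lastF: "?y = P ! (?l - 1)" using ne by (simp add: last_conv_nth)
  have "inj_on ((!) P) (insert (?l - 1) J)"
    using dP ne by (auto simp: inj_on_def J_def nth_eq_iff_index_eq)
  then have "card F = card (insert (?l - 1) J)" unfolding F_def by (rule card_image)
  also have "\<dots> = d + 1" using J(1,3) ne by (subst card_insert_disjoint) (auto simp: J_def d_def)
  finally have cF: "card F = d + 1" .
  have FA: "F \<subseteq> A" using J(2) la lastF by (auto simp: F_def)
  have Fd: "card (nbrs B u) \<le> d" if "u \<in> F" for u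
  proof -
    consider "u = ?y" | j where "j \<in> J" "u = P ! j" using \<open>u \<in> F\<close> lastF by (auto simp: F_def)
    then show ?thesis
    proof cases
      case 1
      then show ?thesis
        using mx[of "rev P"] longest_rev[OF P] h la ne by (simp add: hd_rev last_rev d_def)
    next
      case 2
      then have j: "Suc j < ?l" "R ?x (P ! Suc j)" by (auto simp: J_def)
      note rot = is_path_rotate[OF Pp j]
      have "longest_path V (rev (take (Suc j) P) @ drop (Suc j) P)"
        using longest_cong[OF P rot(1,4)] .
      then show ?thesis using mx[of "rev (take (Suc j) P) @ drop (Suc j) P"] rot(2,3) la J(2)[OF 2(1)] 2
        unfolding d_def by metis
    qed
  qed
  have fF: "finite F" using FA finA by (rule finite_subset)
  have split: "edge_count A B = edge_count F B + edge_count (A - F) B"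
    using FA by (intro edge_count_split_left) auto
  have cAF: "card (A - F) = s - (d + 1)" using FA fF cF a by (simp add: card_Diff_subset)
  have e1: "edge_count F B \<le> (d + 1) * d" using edge_count_le[of F B d] Fd cF by simp
  have Ad: "card (nbrs B u) \<le> s" for u using b by (auto simp: nbrs_def intro!: card_mono)
  have e2: "edge_count (A - F) B \<le> (s - (d + 1)) * s" using edge_count_le[of "A - F" B s] Ad cAF by simp
  obtain d' where d': "d = Suc d'" using dx by (cases d) auto
  obtain e where e: "s = d' + 3 + e" using ds d' by (auto simp: le_iff_add)
  have id: "(d + 1) * d + (s - (d + 1)) * s + 2 * s + d' * e = s * s + 2"
    unfolding d' e by (simp add: algebra_simps)
  show "edge_count A B + 2 * s \<le> s * s + 2" using id e1 e2 split by linarith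
  assume eq: "edge_count A B + 2 * s = s * s + 2"
  have "d' * e = 0" and t1: "edge_count F B = card F * d" and t2: "edge_count (A - F) B = card (A - F) * s"
    unfolding cF cAF using id e1 e2 split eq by linarith+
  have degF: "card (nbrs B u) = d" if "u \<in> F" for u
    using edge_count_tight[OF fF Fd t1 that] .
  have degA: "R u v" if "u \<in> A - F" "v \<in> B" for u v
    using edge_count_tight[OF _ Ad t2 that(1)] b that(2) by (intro nbrs_full[of B]) auto
  show "pendant_structure (s - 2) A B"
  proof (cases "d' = 0")
    case True
    have "A - (A - F) = F" using FA by auto
    then show ?thesis
      unfolding pendant_structure_def using degA degF True d' cAF
      by (intro exI[of _ "A - F"]) auto
  next
    case False
    then have e0: "e = 0" using \<open>d' * e = 0\<close> by simp
    then have ds: "d = s - 2" "card (A - F) = 1" using e d' cAF by auto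
    \<comment> \<open>The degree of \<open>z\<close> is at least 1, so \<open>?l div 2\<close> must
      be \<open>s - 1\<close>. Hence \<open>P\<close> covers \<open>A\<close>, and the single vertex
      \<open>c\<close> of \<open>A - F\<close> lies on \<open>P\<close> and sees
      \<open>z\<close>.\<close>
    have ll: "?l = 2 * s - 1" using z dz l ds s by presburger
    obtain c where c: "A - F = {c}" using ds(2) by (auto simp: card_1_singleton_iff)
    have cz: "R c z" using degA c z by auto
    have "card (set P \<inter> A) = s" using path_card(2)[OF Pp h] ll s by simp
    then have "set P \<inter> A = A" using a by (intro card_subset_eq) auto
    then obtain j where j: "j < ?l" "c = P ! j" using c by (metis Diff_iff Int_iff in_set_conv_nth insertI1)
    have cA: "c \<in> A" "c \<notin> F" using c by auto
    have ej: "even j" using path_parity(1)[OF Pp h j(1)] j cA by simp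
    have jl: "j \<noteq> ?l - 1" using cA j lastF by (auto simp: F_def)
    then have jl3: "j + 3 \<le> ?l" using j ej l by presburger
    have "R (P ! 0) (P ! Suc 0)" using is_path_nth[OF Pp, of 0] ll s by simp
    then have "0 \<in> J" using ll s ne by (simp add: J_def hd_conv_nth)
    then have j0: "j \<noteq> 0" using cA j by (auto simp: F_def)
    have zp: "is_path (V - set P) [z]" using z by (intro is_path_single) auto
    have nx: "\<not> R ?x (P ! (j + 1))"
      using tail_chord[OF P zp j(1), of "j + 1"] j cz jl3 by auto
    have rl: "rev P ! (?l - 1 - i) = P ! i" if "i < ?l" for i using that by (simp add: rev_nth)
    have rh: "hd (rev P) = ?y" "last (rev P) = ?x" using ne by (auto simp: hd_rev last_rev)
    have ny: "\<not> R ?y (P ! (j - 1))"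
    proof
      assume "R ?y (P ! (j - 1))"
      then have "?l - 1 - j + length [z] < ?l - 1 - (j - 1)"
        using zp cz j j0 rl[of j] rl[of "j - 1"] rh
        by (intro tail_chord[OF longest_rev[OF P]]) auto
      then show False using j j0 by simp
    qed
    \<comment> \<open>\<open>v\<close> has \<open>s - 2\<close> neighbours among the
      \<open>s - 1\<close> odd positions, so the known non-neighbour \<open>k\<close> is the only
      one.\<close>
    have full: "R v (P ! m)" if v: "v \<in> F" "nbrs B v \<subseteq> set P" "\<not> R v (P ! k)" "odd k" "k < ?l"
      and m: "odd m" "m < ?l" "m \<noteq> k" for v k m
    proof -
      have vA: "v \<in> A" using v FA by auto
      have "nbrs B v \<subseteq> (!) P ` {i. i < ?l \<and> R v (P ! i)}"
        using v(2) by (auto simp: in_set_conv_nth subset_iff)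
      then have "d \<le> card {i. i < ?l \<and> R v (P ! i)}"
        using degF[OF v(1)] surj_card_le[of "{i. i < ?l \<and> R v (P ! i)}" "nbrs B v" "(!) P"] by simp
      moreover have sub: "{i. i < ?l \<and> R v (P ! i)} \<subseteq> {i. i < ?l \<and> odd i} - {k}"
        using v(3) vA indepA path_parity(1)[OF Pp h] by auto
      moreover have "card ({i. i < ?l \<and> odd i} - {k}) = d"
        using v(4,5) ll s ds by (subst card_Diff_singleton) (auto simp: card_odd_less)
      ultimately have "{i. i < ?l \<and> R v (P ! i)} = {i. i < ?l \<and> odd i} - {k}"
        by (intro card_seteq) auto
      then show ?thesis using m by auto
    qed
    have xF: "?x \<in> F" using \<open>0 \<in> J\<close> ne by (auto simp: F_def hd_conv_nth)
    have yF: "?y \<in> F" using lastF by (auto simp: F_def)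
    have nbx: "nbrs B ?x \<subseteq> set P" using longest_hd_nbr[OF P] by auto
    have nby: "nbrs B ?y \<subseteq> set P" using longest_last_nbr[OF P] by auto
    have fx: "R ?x (P ! m)" if "odd m" "m < ?l" "m \<noteq> j + 1" for m
      using full[OF xF nbx nx] ej jl3 that by auto
    have fy: "R ?y (P ! m)" if "odd m" "m < ?l" "m \<noteq> j - 1" for m
      using full[OF yF nby ny] ej j0 j that by auto
    have zV: "z \<in> V" using z by simp
    \<comment> \<open>The detour at \<open>c\<close> needs position \<open>j + 3\<close>. If
      \<open>c\<close> is third from the end, it is made in the reversed path, where
      \<open>c\<close> has position 2; \<open>4 \<le> s\<close> guarantees the position 5 needed
      there.\<close>
    show ?thesis
    proof (cases "j + 3 < ?l")
      case True
      have "R ?x (P ! (j + 3))" using True ej by (intro fx) auto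
      moreover have "R ?y (P ! (j + 1))" using True ej by (intro fy) auto
      ultimately show ?thesis using longest_detour[OF P zV z(2), of j] True cz j by auto
    next
      case False
      then have jj: "j = ?l - 3" using jl3 by simp
      have l7: "?l \<ge> 7" using ll s by simp
      have "R ?y (P ! (?l - 6))" using l7 l jj by (intro fy) auto
      then have 1: "R (hd (rev P)) (rev P ! (2 + 3))" using rl[of "?l - 6"] l7 rh by simp
      have "R ?x (P ! (?l - 4))" using l7 l jj by (intro fx) auto
      then have 2: "R (last (rev P)) (rev P ! (2 + 1))" using rl[of "?l - 4"] l7 rh by simp
      have "R (rev P ! 2) z" using rl[of "?l - 3"] l7 jj j cz by simp
      then show ?thesis using longest_detour[OF longest_rev[OF P] zV _ _ _ 1 2] z l7 by auto
    qed
  qed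
qed

end


section \<open>The square case with path ends in different classes\<close>

context bip
begin

text \<open>Rotating at one end fixes the other, so maximality of the degree sum bounds the degrees
  of the rotated ends separately: \<open>d\<close> heads of degree at most \<open>d\<close> and
  \<open>f\<close> last vertices of degree at most \<open>f\<close>. This may miss the bound by one,
  hence a further non-adjacent pair is required. The last conclusion treats a pendant end in
  \<open>A\<close>; reversal and exchange of the classes give the other orientation.\<close>

lemma square_case_mixed_ends:
  assumes cV: "conn V" and a: "card A = s" and b: "card B = s" and s: "4 \<le> s"
    and free: "\<And>xs. is_path V xs \<Longrightarrow> length xs < 2 * s"
    and P: "longest_path V P" and h: "hd P \<in> A" and la: "last P \<in> B"
    and mx: "\<And>P'. longest_path V P' \<Longrightarrow> hd P' \<in> A \<Longrightarrow> last P' \<in> B \<Longrightarrow>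
      card (nbrs B (hd P')) + card (nbrs A (last P')) \<le> card (nbrs B (hd P)) + card (nbrs A (last P))"
  shows "edge_count A B + 2 * s \<le> s * s + 2"
    and "edge_count A B + 2 * s = s * s + 2 \<Longrightarrow> card (nbrs B (hd P)) = 1 \<or> card (nbrs A (last P)) = 1"
    and "edge_count A B + 2 * s = s * s + 2 \<Longrightarrow> card (nbrs B (hd P)) = 1 \<Longrightarrow> pendant_structure (s - 2) A B"
proof -
  let ?x = "hd P" and ?y = "last P" and ?l = "length P"
  define d where "d = card (nbrs B ?x)"
  define f where "f = card (nbrs A ?y)"
  have Pp: "is_path V P" using P by (rule longest_is_path)
  have dP: "distinct P" and ne: "P \<noteq> []" using Pp by (auto simp: is_path_def)
  have l: "even ?l" "?l < 2 * s" using path_length_parity[OF Pp h] la free[OF Pp] by auto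
  have cPB: "card (set P \<inter> B) = ?l div 2" and cPA: "card (set P \<inter> A) = ?l div 2"
    using path_card[OF Pp h] l(1) by (auto elim!: evenE)
  have lastP: "?y = P ! (?l - 1)" using ne by (simp add: last_conv_nth)
  have hdP: "?x = P ! 0" using ne by (simp add: hd_conv_nth)
  have cAo: "card (A - set P) = s - ?l div 2"
    using card_Diff_subset_Int[of A "set P"] cPA a by (simp add: Int_commute)
  have cBo: "card (B - set P) = s - ?l div 2"
    using card_Diff_subset_Int[of B "set P"] cPB b by (simp add: Int_commute)
  have Ao: "A - set P \<noteq> {}" and Bo: "B - set P \<noteq> {}" 
    using cAo cBo l(2) by (metis card.empty diff_is_0_eq leD less_mult_imp_div_less mult.commute)+
  then have out: "set P \<noteq> V" by auto
  note mp = ends_mixed_pair[OF cV P h la out]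
  have df: "d + f \<le> ?l div 2" using mp(1) by (simp add: d_def f_def)
  have l4: "?l \<ge> 4" by (rule mp(3))
  have xy: "?x \<noteq> ?y" using h la disj by auto
  have dx: "d \<ge> 1"
    using conn_nbr[OF cV, of ?x ?y] h la xy nbrs_A[OF h] unfolding d_def by (simp add: Suc_le_eq card_gt_0_iff)
  have fy: "f \<ge> 1"
    using conn_nbr[OF cV, of ?y ?x] h la xy nbrs_B[OF la] unfolding f_def by (simp add: Suc_le_eq card_gt_0_iff)
  define J where "J = {j. Suc j < ?l \<and> R ?x (P ! Suc j)}"
  define K where "K = {j. Suc j < ?l \<and> R ?y (P ! j)}"
  note J = hd_shift[OF P h, folded J_def] and K = last_shift[OF P h la, folded K_def]
  define FA where "FA = (!) P ` J"
  define FB where "FB = (\<lambda>j. P ! Suc j) ` K"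
  have cFA: "card FA = d" unfolding FA_def d_def
    using dP J(1) by (subst card_image) (auto simp: inj_on_def J_def nth_eq_iff_index_eq)
  have cFB: "card FB = f" unfolding FB_def f_def
    using dP K(1) by (subst card_image) (auto simp: inj_on_def K_def nth_eq_iff_index_eq)
  have FA: "FA \<subseteq> A" using J(2) by (auto simp: FA_def)
  have FB: "FB \<subseteq> B" using K(2) by (auto simp: FB_def)
  have FAP: "FA \<subseteq> set P" by (auto simp: FA_def J_def)
  have FBP: "FB \<subseteq> set P" by (auto simp: FB_def K_def)
  have FAd: "card (nbrs B u) \<le> d" if "u \<in> FA" for u
  proof -
    obtain j where j: "Suc j < ?l" "R ?x (P ! Suc j)" "u = P ! j" using \<open>u \<in> FA\<close> by (auto simp: FA_def J_def)
    note rot = is_path_rotate[OF Pp j(1,2)]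
    have "longest_path V (rev (take (Suc j) P) @ drop (Suc j) P)"
      using longest_cong[OF P rot(1,4)] .
    then have "card (nbrs B u) + f \<le> d + f"
      using mx[of "rev (take (Suc j) P) @ drop (Suc j) P"] \<open>u \<in> FA\<close> FA la j(3)
      unfolding rot(2,3) d_def f_def by auto
    then show ?thesis by simp
  qed
  have FBlast: "card (nbrs A v) \<le> f \<and> nbrs A v \<subseteq> set P" if "v \<in> FB" for v
  proof -
    obtain j where j: "Suc j < ?l" "R ?y (P ! j)" "v = P ! Suc j" using \<open>v \<in> FB\<close> by (auto simp: FB_def K_def)
    note rot = is_path_rotate_last[OF Pp j(1,2)]
    have lg: "longest_path V (take (Suc j) P @ rev (drop (Suc j) P))"
      using longest_cong[OF P rot(1,4)] .
    then have "d + card (nbrs A v) \<le> d + f"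
      using mx[of "take (Suc j) P @ rev (drop (Suc j) P)"] \<open>v \<in> FB\<close> FB h j(3)
      unfolding rot(2,3) d_def f_def by auto
    moreover have "nbrs A v \<subseteq> set P"
      using longest_last_nbr[OF lg, unfolded rot(3,5)] j(3) by auto
    ultimately show ?thesis by simp
  qed
  have finF: "finite FA" "finite FB" using FA FB finite_subset[OF _ finA] finite_subset[OF _ finB] by auto
  define X where "X = {(u, v) \<in> (A - FA) \<times> (B - FB). \<not> R u v}"
  have finX: "finite X" unfolding X_def by (rule finite_subset[of _ "A \<times> B"]) auto
  have insert2: "\<not> R (P ! i) r \<or> \<not> R r' (P ! Suc i)"
    if "r \<in> V - set P" "r' \<in> V - set P" "R r r'" "Suc i < ?l" for r r' i
  proof -
    have "r \<noteq> r'" using that indepA indepB by blast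
    then have "is_path (V - set P) [r, r']" using that by (simp add: is_path_def)
    then show ?thesis using tail_insert[OF P, of "[r, r']" i "Suc i"] that by auto
  qed
  have rl: "rev P ! (?l - 1 - i) = P ! i" if "i < ?l" for i using that by (simp add: rev_nth)
  have rh: "hd (rev P) = ?y" "last (rev P) = ?x" using ne by (auto simp: hd_rev last_rev)
  \<comment> \<open>If \<open>X\<close> were empty, the vertices outside \<open>P\<close> would span
    a complete bipartite graph, because rotated ends lie on \<open>P\<close>. An edge from position
    \<open>i\<close> into it continues to a second outside vertex, which cannot be adjacent to the
    neighbouring vertex of \<open>P\<close>. If that vertex were a rotated end,
    \<open>tail_chord\<close> would give a longer path; so the two form a pair in \<open>X\<close>
    after all.\<close>
  have "X \<noteq> {}"
  proof
    assume X0: "X = {}"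
    have adj: "R u v" "R v u" if "u \<in> A - set P" "v \<in> B - set P" for u v
    proof -
      have "(u, v) \<notin> X" using X0 by simp
      then show "R u v" using that FAP FBP by (auto simp: X_def)
      then show "R v u" by (rule sym)
    qed
    obtain x0 where x0: "x0 \<in> A - set P" using Ao by blast
    have "reach V x0 ?x" "?x \<notin> V - set P" "x0 \<in> V - set P"
      using cV x0 is_path_ends[OF Pp] by (auto simp: conn_def)
    then obtain r p where "r \<in> component (V - set P) x0" "p \<in> V - (V - set P)" "R r p"
      using reach_exit by metis
    then have r: "r \<in> V - set P" "p \<in> set P" "R r p"
      using comp_subset[of "V - set P" x0] by auto
    obtain i where i: "i < ?l" "R (P ! i) r" using r by (auto simp: in_set_conv_nth dest: sym)
    show False
    proof (cases "r \<in> A")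
      case True
      obtain y' where y': "y' \<in> B - set P" using Bo by blast
      have rA: "r \<in> A - set P" using True r by auto
      note ry = adj[OF rA y']
      have "r \<noteq> y'" using True y' disj by auto
      then have Q: "is_path (V - set P) [r, y']" using ry r y' by (simp add: is_path_def)
      have i2: "i + 2 < ?l" using tail_end(2)[OF P Q i(1)] i by simp
      have oi: "odd i" using path_parity[OF Pp h, of i] is_path_in[OF Pp, of i] indepA True i by auto
      have n1: "\<not> R (P ! Suc i) y'"
        using insert2[of r y' i] ry r y' i i2 by (auto dest: sym)
      have "P ! Suc i \<in> A" using path_parity(1)[OF Pp h, of "Suc i"] i2 oi by simp
      moreover have "P ! Suc i \<notin> FA"
      proof
        assume "P ! Suc i \<in> FA"
        then obtain j where j: "j \<in> J" "P ! Suc i = P ! j" by (auto simp: FA_def)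
        then have "j = Suc i" using dP i2 by (auto simp: J_def nth_eq_iff_index_eq)
        then have "R ?x (P ! (i + 2))" using j by (simp add: J_def)
        then show False using tail_chord[OF P Q i(1), of "i + 2"] i i2 by simp
      qed
      ultimately have "(P ! Suc i, y') \<in> X" using n1 y' FBP by (auto simp: X_def)
      then show False using X0 by simp
    next
      case False
      then have rB: "r \<in> B" using r by auto
      obtain x' where x': "x' \<in> A - set P" using Ao by blast
      have rB': "r \<in> B - set P" using rB r by auto
      note rx = adj[OF x' rB']
      have "r \<noteq> x'" using rB x' disj by auto
      then have Q: "is_path (V - set (rev P)) [r, x']" using rx r x' by (simp add: is_path_def)
      have ri: "?l - 1 - i < length (rev P)" "R (rev P ! (?l - 1 - i)) (hd [r, x'])"
        using i rl[of i] by auto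
      have "?l - 1 - i + 2 < ?l" using tail_end(2)[OF longest_rev[OF P] Q ri] by simp
      then have i2: "i \<ge> 2" by linarith
      have ei: "even i" using path_parity[OF Pp h, of i] is_path_in[OF Pp, of i] indepB rB i by auto
      have n1: "\<not> R x' (P ! (i - 1))"
        using insert2[of x' r "i - 1"] rx r x' i i2 by (auto dest: sym)
      have "P ! (i - 1) \<in> B" using path_parity(2)[OF Pp h, of "i - 1"] i i2 ei by simp
      moreover have "P ! (i - 1) \<notin> FB"
      proof
        assume "P ! (i - 1) \<in> FB"
        then obtain j where j: "j \<in> K" "P ! (i - 1) = P ! Suc j" by (auto simp: FB_def)
        then have "Suc j = i - 1" using dP i by (auto simp: K_def nth_eq_iff_index_eq)
        then have "j = i - 2" by simp
        then have "R ?y (P ! (i - 2))" using j by (simp add: K_def)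
        then have "?l - 1 - i + length [r, x'] < ?l - 1 - (i - 2)"
          using rl[of "i - 2"] rh i i2 by (intro tail_chord[OF longest_rev[OF P] Q ri]) auto
        then show False using i i2 by simp
      qed
      ultimately have "(x', P ! (i - 1)) \<in> X" using n1 x' FAP by (auto simp: X_def)
      then show False using X0 by simp
    qed
  qed
  then have X1: "card X \<ge> 1" using finX by (simp add: Suc_le_eq card_gt_0_iff)
  have "edge_count A B = edge_count FA B + edge_count (A - FA) B"
    using FA by (intro edge_count_split_left) auto
  also have "edge_count (A - FA) B = edge_count (A - FA) FB + edge_count (A - FA) (B - FB)"
    using FB by (intro edge_count_split_right) auto
  also have "edge_count (A - FA) FB = edge_count FB (A - FA)"
    using finF by (intro edge_count_swap) auto
  finally have split: "edge_count A B = edge_count FA B + (edge_count FB (A - FA) + edge_count (A - FA) (B - FB))" .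
  have FBd: "card (nbrs (A - FA) v) \<le> f" if "v \<in> FB" for v
  proof -
    have "card (nbrs (A - FA) v) \<le> card (nbrs A v)" by (intro card_mono) auto
    then show ?thesis using FBlast[OF that] by linarith
  qed
  have e1: "edge_count FA B \<le> d * d" using edge_count_le[OF FAd, of FA] cFA by simp
  have e2: "edge_count FB (A - FA) \<le> f * f" using edge_count_le[OF FBd, of FB] cFB by simp
  have cA': "card (A - FA) = s - d" using card_Diff_subset[OF finF(1) FA] cFA a by simp
  have cB': "card (B - FB) = s - f" using card_Diff_subset[OF finF(2) FB] cFB b by simp
  have e3: "edge_count (A - FA) (B - FB) + card X = (s - d) * (s - f)"
    using edge_count_compl[of "A - FA" "B - FB"] cA' cB' by (simp add: X_def)
  obtain d' where d': "d = Suc d'" using dx by (cases d) auto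
  obtain f' where f': "f = Suc f'" using fy by (cases f) auto
  have "d + f + 1 \<le> s" using df l by linarith
  then obtain e where e: "s = d' + f' + 3 + e" using d' f' by (auto simp: le_iff_add)
  \<comment> \<open>Here \<open>e = s - 1 - d - f\<close>. The right-hand side is one more than
    wanted, which \<open>card X \<ge> 1\<close> compensates. Equality makes the gap vanish, so
    \<open>d = 1\<close> or \<open>f = 1\<close>.\<close>
  have id: "d * d + (f * f + (s - d) * (s - f)) + 2 * s + ((d' + f') * e + d' * f') = s * s + 3"
    unfolding d' f' e by (simp add: algebra_simps)
  show "edge_count A B + 2 * s \<le> s * s + 2" using id e1 e2 e3 split X1 by linarith
  assume eq: "edge_count A B + 2 * s = s * s + 2"
  have z: "(d' + f') * e + d' * f' = 0" and cX: "card X = 1"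
    and t1: "edge_count FA B = d * d" and t2: "edge_count FB (A - FA) = card FB * f"
    unfolding cFB using id e1 e2 e3 split X1 eq by linarith+
  then show "card (nbrs B ?x) = 1 \<or> card (nbrs A ?y) = 1" using d' f' by (auto simp: d_def f_def)
  assume "card (nbrs B ?x) = 1"
  then have d1: "d = 1" "d' = 0" using d' by (auto simp: d_def)
  have R01: "R (P ! 0) (P ! Suc 0)" using is_path_nth[OF Pp, of 0] l4 by simp
  then have "0 \<in> J" using l4 hdP by (auto simp: J_def)
  then have "?x \<in> FA" using hdP by (auto simp: FA_def)
  then have FAx: "FA = {?x}" using cFA d1 by (auto simp: card_1_singleton_iff)
  have tFB: "card (nbrs (A - {?x}) v) = f" if "v \<in> FB" for v
    using edge_count_tight[OF finF(2) FBd t2 that] FAx by simp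
  obtain u0 v0 where X: "X = {(u0, v0)}" using cX by (metis card_1_singletonE surj_pair)
  have adj: "R u v" "R v u" if "u \<in> A" "u \<noteq> ?x" "v \<in> B" "v \<notin> FB" "(u, v) \<noteq> (u0, v0)" for u v
  proof -
    have "(u, v) \<notin> X" using X that by simp
    then show "R u v" using that FAx by (auto simp: X_def)
    then show "R v u" by (rule sym)
  qed
  have nin: "P ! i \<noteq> P ! j" if "i < ?l" "j < ?l" "i \<noteq> j" for i j
    using that dP by (simp add: nth_eq_iff_index_eq)
  have inX: "(u, v) = (u0, v0)" if "u \<in> A" "u \<noteq> ?x" "v \<in> B" "v \<notin> FB" "\<not> R u v" for u v
    using adj(1)[OF that(1-4)] that(5) by blast
  have pA: "P ! i \<in> A \<longleftrightarrow> even i" and pB: "P ! i \<in> B \<longleftrightarrow> odd i" if "i < ?l" for i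
    using path_parity[OF Pp h that] by auto
  have P1FB: "P ! 1 \<notin> FB"
  proof
    assume "P ! 1 \<in> FB"
    then obtain j where j: "j \<in> K" "P ! 1 = P ! Suc j" by (auto simp: FB_def)
    then have "j = 0" using dP l4 by (auto simp: K_def nth_eq_iff_index_eq)
    then show False using j hdP mp(2) by (auto simp: K_def dest: sym)
  qed
  show "pendant_structure (s - 2) A B"
  proof (cases "f' = 0")
    case False
    \<comment> \<open>A vanishing gap with \<open>d = 1 < f\<close> forces \<open>e = 0\<close>;
      then \<open>P\<close> misses exactly one vertex of each class.\<close>
    then have fs: "f = s - 2" using z d1 e f' by auto
    then have ll: "?l = 2 * s - 2" using df d1 l s by presburger
    have l6: "?l \<ge> 6" using ll s by simp
    have lh: "?l div 2 = s - 1" using ll s by presburger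
    have cA1: "card (A - set P) = 1" and cB1: "card (B - set P) = 1" unfolding cAo cBo lh using s by auto
    obtain x' where x': "A - set P = {x'}" using cA1 by (auto simp: card_1_singleton_iff)
    obtain y' where y': "B - set P = {y'}" using cB1 by (auto simp: card_1_singleton_iff)
    have x'A: "x' \<in> A" "x' \<notin> set P" and y'B: "y' \<in> B" "y' \<notin> set P" using x' y' by auto
    have "FB \<subseteq> set P \<inter> B - {P ! 1}" using FB FBP P1FB by auto
    moreover have "card (set P \<inter> B - {P ! 1}) = f"
      using cPB lh fs pB[of 1] l6 s by (subst card_Diff_singleton) auto
    ultimately have FBe: "FB = set P \<inter> B - {P ! 1}" using cFB by (intro card_subset_eq) auto
    have Bsplit: "v = P ! 1 \<or> v = y'" if "v \<in> B" "v \<notin> FB" for v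
      using that FBe y' by blast
    have x'FB: "\<not> R v x'" if "v \<in> FB" for v using FBlast[OF that] x'A by auto
    have x'x: "x' \<noteq> ?x" using x'A is_path_ends[OF Pp] by auto
    have y'FB: "y' \<notin> FB" using FBP y'B by auto
    have B1: "P ! 1 \<in> B" using pB[of 1] l6 by simp
    show ?thesis
    proof (cases "R x' y'")
      case False
      have X': "(u0, v0) = (x', y')" using inX[of x' y'] x'A x'x y'B y'FB False by auto
      have "P ! 1 \<noteq> y'" using y'B l6 by auto
      then have R1: "R x' (P ! 1)" using adj(1)[of x' "P ! 1"] x'A x'x B1 P1FB X' by auto
      have "nbrs B x' = {P ! 1}"
      proof
        show "{P ! 1} \<subseteq> nbrs B x'" using R1 B1 by simp
        show "nbrs B x' \<subseteq> {P ! 1}"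
        proof
          fix v assume v: "v \<in> nbrs B x'"
          then have "v \<notin> FB" using x'FB sym[of x' v] by auto
          then show "v \<in> {P ! 1}" using Bsplit[of v] v False by auto
        qed
      qed
      then have dx': "card (nbrs B x') = 1" by simp
      define T where "T = A - {?x, x'}"
      have cT: "card T = s - 2" unfolding T_def using a x'A h x'x by (subst card_Diff_subset) auto
      have full: "R u v" if "u \<in> T" "v \<in> B" for u v
      proof (cases "v \<in> FB")
        case True
        have "nbrs (A - {?x}) v \<subseteq> T" using x'FB[OF True] by (auto simp: T_def)
        then have "nbrs (A - {?x}) v = T"
          using tFB[OF True] cT fs by (intro card_subset_eq) (auto simp: T_def)
        then show ?thesis using that by (auto dest: sym)
      next
        case False
        then show ?thesis using adj(1)[of u v] that X' by (auto simp: T_def)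
      qed
      have "A - T \<subseteq> {?x, x'}" by (auto simp: T_def)
      then have "card (nbrs B u) = 1" if "u \<in> A - T" for u
        using that dx' d1 unfolding d_def by auto
      then show ?thesis unfolding pendant_structure_def using cT full by (intro exI[of _ T]) (auto simp: T_def)
    next
      case True
      have P2: "P ! 2 \<in> A" "P ! 2 \<noteq> ?x" "P ! 4 \<in> A" "P ! 4 \<noteq> ?x" "P ! 4 \<noteq> P ! 2"
        using pA[of 2] pA[of 4] nin[of 2 0] nin[of 4 0] nin[of 4 2] l6 hdP ne by auto
      have P24: "P ! 2 \<in> set P" "P ! 4 \<in> set P" using l6 by auto
      \<comment> \<open>The only pair of \<open>X\<close> is used up by the failure to insert
        \<open>x'\<close>, \<open>y'\<close> behind position 1, so \<open>y'\<close> sees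
        \<open>P ! 4\<close>. As \<open>P ! 3\<close> is a rotated end, \<open>?y\<close> sees
        \<open>P ! 2\<close>. The path built from these edges omits only \<open>P ! 3\<close> and
        gains both \<open>x'\<close> and \<open>y'\<close>.\<close>
      have "\<not> R (P ! 1) x' \<or> \<not> R y' (P ! Suc 1)"
        using insert2[of x' y' 1] x'A y'B True l6 by auto
      then have "(u0, v0) = (x', P ! 1) \<or> (u0, v0) = (P ! 2, y')"
        using inX[of x' "P ! 1"] inX[of "P ! 2" y'] x'A x'x B1 P1FB P2 y'B y'FB
        by (auto simp: numeral_2_eq_2 dest: sym)
      then have "R y' (P ! 4)"
        using adj(2)[of "P ! 4" y'] P2 P24 x'A y'B y'FB by auto
      moreover have "P ! 3 \<in> FB" using FBe pB[of 3] nin[of 3 1] l6 by auto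
      then obtain j where j: "j \<in> K" "P ! 3 = P ! Suc j" by (auto simp: FB_def)
      then have "Suc j = 3" using dP l6 by (auto simp: K_def nth_eq_iff_index_eq)
      then have "R ?y (P ! 2)" using j by (simp add: K_def)
      moreover obtain p0 p1 p2 p3 D where eqP: "P = p0 # p1 # p2 # p3 # D"
        using l6 by (auto simp: numeral_eq_Suc Suc_le_length_iff)
      moreover have D: "D \<noteq> []" using l6 eqP by auto
      ultimately have R: "R y' (hd D)" "R (last D) p2" by (auto simp: hd_conv_nth)
      have "is_path V ([x', y'] @ D @ [p2, p1, p0])"
        using R D True Pp x'A y'B disj unfolding eqP is_path_def
        by (auto simp: successively_append_iff successively_Cons sym)
      from longestD[OF P this] eqP show ?thesis by simp
    qed
  next
    case True
    \<comment> \<open>Now all pairs that avoid \<open>?x\<close> and \<open>?y\<close> are adjacent,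
      with one exception. With two outside vertices in each class the exception can be dodged; with
      one in each class, either two exceptions or a longer path results.\<close>
    then have f1: "f = 1" using f' by simp
    have l21: "Suc (?l - 2) = ?l - 1" using l4 by simp
    have "R (P ! (?l - 2)) ?y" using is_path_nth[OF Pp, of "?l - 2"] l4 lastP unfolding l21 by simp
    then have "?l - 2 \<in> K" using l4 sym by (auto simp: K_def)
    then have "?y \<in> FB" unfolding FB_def using l21 lastP by (metis imageI)
    then have FBy: "FB = {?y}" using cFB f1 by (auto simp: card_1_singleton_iff)
    have B1: "P ! 1 \<in> B" using pB[of 1] l4 by simp
    have A2: "P ! 2 \<in> A" "P ! 2 \<noteq> ?x" using pA[of 2] nin[of 2 0] l4 hdP ne by auto
    have P12: "P ! 1 \<in> set P" "P ! 2 \<in> set P" using l4 by auto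
    have xP: "?x \<in> set P" using is_path_ends[OF Pp] by simp
    have "False"
    proof (cases "?l div 2 + 2 \<le> s")
      case True
      have "card (A - set P) - 1 \<le> card (A - set P - {u0})" "card (B - set P) - 1 \<le> card (B - set P - {v0})"
        using diff_card_le_card_Diff[of "{u0}" "A - set P"] diff_card_le_card_Diff[of "{v0}" "B - set P"]
        by simp_all
      then have "card (A - set P - {u0}) > 0" "card (B - set P - {v0}) > 0"
        using cAo cBo True by linarith+
      then have "A - set P - {u0} \<noteq> {}" "B - set P - {v0} \<noteq> {}" unfolding card_gt_0_iff by blast+
      then obtain x' y' where x': "x' \<in> A" "x' \<notin> set P" "x' \<noteq> u0" and y': "y' \<in> B" "y' \<notin> set P" "y' \<noteq> v0"
        by blast
      have "x' \<noteq> ?x" "y' \<notin> FB" using x' y' xP FBP by auto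
      then have "R x' y'" "R (P ! 1) x'" "R y' (P ! 2)"
        using adj(1)[of x' y'] adj(2)[of x' "P ! 1"] adj(2)[of "P ! 2" y'] x' y' B1 P1FB A2 by auto
      then show False using insert2[of x' y' 1] x' y' l4 by (auto simp: numeral_2_eq_2)
    next
      case False
      then have ll: "?l = 2 * s - 2" using l by presburger
      then have l6: "?l \<ge> 6" using s by simp
      obtain x' y' where x': "x' \<in> A" "x' \<notin> set P" and y': "y' \<in> B" "y' \<notin> set P"
        using Ao Bo by blast
      have xy': "x' \<noteq> ?x" "y' \<notin> FB" using x' y' xP FBP by auto
      have B3: "P ! 3 \<in> B" "P ! 3 \<notin> FB" using pB[of 3] nin[of 3 "?l - 1"] l6 lastP FBy by auto
      have A4: "P ! 4 \<in> A" "P ! 4 \<noteq> ?x" "P ! 4 \<noteq> P ! 2" "P ! 1 \<noteq> P ! 3"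
        using pA[of 4] nin[of 4 0] nin[of 4 2] nin[of 1 3] l6 hdP ne by auto
      have P34: "P ! 3 \<in> set P" "P ! 4 \<in> set P" using l6 by auto
      show False
      proof (cases "R x' y'")
        case True
        have "\<not> R (P ! 1) x' \<or> \<not> R y' (P ! Suc 1)" "\<not> R (P ! 3) x' \<or> \<not> R y' (P ! Suc 3)"
          using insert2[of x' y' 1] insert2[of x' y' 3] x' y' True l6 by auto
        then have "\<not> R x' (P ! 1) \<or> \<not> R (P ! 2) y'" "\<not> R x' (P ! 3) \<or> \<not> R (P ! 4) y'"
          by (auto simp: eval_nat_numeral dest: sym)
        then have "(u0, v0) = (x', P ! 1) \<or> (u0, v0) = (P ! 2, y')"
          "(u0, v0) = (x', P ! 3) \<or> (u0, v0) = (P ! 4, y')"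
          using inX[of x' "P ! 1"] inX[of "P ! 2" y'] inX[of x' "P ! 3"] inX[of "P ! 4" y']
            x' y' xy' B1 P1FB A2 B3 A4 by auto
        then show False using A4 x' y' P12 P34 by auto
      next
        case False
        have X': "(u0, v0) = (x', y')" using inX[of x' y'] x' y' xy' False by auto
        have ne': "P ! 1 \<noteq> y'" "P ! 3 \<noteq> y'" "P ! 2 \<noteq> x'" "P ! 4 \<noteq> x'" using P12 P34 x' y' by auto
        have R1: "R (P ! 1) x'" using adj(2)[of x' "P ! 1"] x' xy' B1 P1FB X' ne' by auto
        have R2: "R x' (P ! 3)" using adj(1)[of x' "P ! 3"] x' xy' B3 X' ne' by auto
        have R3: "R (P ! 2) y'" using adj(1)[of "P ! 2" y'] y' xy' A2 X' ne' by auto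
        have R4: "R y' (P ! 4)" using adj(2)[of "P ! 4" y'] y' xy' A4 X' ne' by auto
        obtain p0 p1 p2 p3 D where eqP: "P = p0 # p1 # p2 # p3 # D"
          using l6 by (auto simp: numeral_eq_Suc Suc_le_length_iff)
        have D: "D \<noteq> []" using l6 eqP by auto
        have R: "R p1 x'" "R x' p3" "R p2 y'" "R y' (hd D)"
          using R1 R2 R3 R4 eqP D by (auto simp: hd_conv_nth)
        \<comment> \<open>The block \<open>p2, p3\<close> is traversed backwards, with
          \<open>x'\<close> before it and \<open>y'\<close> behind it.\<close>
        have "is_path V (p0 # p1 # x' # p3 # p2 # y' # D)"
          using R D Pp x' y' disj unfolding eqP is_path_def
          by (auto simp: successively_Cons sym)
        from longestD[OF P this] eqP show False by simp
      qed
    qed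
    then show ?thesis ..
  qed
qed

end

section \<open>The extremal theorem for symmetric relations\<close>

context bip
begin

lemma card_path_less:
  assumes "is_path V P" "hd P \<in> A" "length P < 2 * s"
  shows "card (set P \<inter> B) < s"
  using path_card(1)[OF assms(1,2)] assms(3) by simp

text \<open>For ends in different classes, equality makes one of the two ends pendant; the class of
  that end decides the orientation of the structure.\<close>

lemma square_case:
  assumes cV: "conn V" and a: "card A = s" and b: "card B = s" and s: "4 \<le> s"
    and free: "\<And>xs. is_path V xs \<Longrightarrow> length xs < 2 * s"
  shows "edge_count A B + 2 * s \<le> s * s + 2"
    and "edge_count A B + 2 * s = s * s + 2 \<Longrightarrow>
      pendant_structure (s - 2) A B \<or> pendant_structure (s - 2) B A"
proof -
  have BA: "B \<union> A = V" by auto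
  interpret sw: bip R B A by (rule swapped)
  have ec: "edge_count B A = edge_count A B" by (rule edge_count_swap) auto
  have "A \<noteq> {}" using a s by auto
  then obtain P where P: "longest_path V P" using longest_ex[of V] by auto
  have Pp: "is_path V P" using P by (rule longest_is_path)
  let ?c = "edge_count A B + 2 * s \<le> s * s + 2 \<and> (edge_count A B + 2 * s = s * s + 2 \<longrightarrow>
      pendant_structure (s - 2) A B \<or> pendant_structure (s - 2) B A)"
  have mixed: ?c if P: "longest_path V P" "hd P \<in> A" "last P \<in> B" for P
  proof -
    let ?good = "\<lambda>P. longest_path V P \<and> hd P \<in> A \<and> last P \<in> B"
    let ?w = "\<lambda>P. card (nbrs B (hd P)) + card (nbrs A (last P))"
    have "\<exists>P. ?good P \<and> (\<forall>P'. ?good P' \<longrightarrow> ?w P' \<le> ?w P)"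
    proof (rule ex_has_greatest_nat)
      show "?good P" using P by blast
      have "card (nbrs B v) \<le> card B" "card (nbrs A v) \<le> card A" for v
        by (auto intro: card_mono)
      then have "card (nbrs B v) \<le> s" "card (nbrs A v) \<le> s" for v
        using a b by auto
      then show "\<forall>P'. ?good P' \<longrightarrow> ?w P' < Suc (s + s)"
        by (auto simp: less_Suc_eq_le intro: add_mono)
    qed
    then obtain P where P: "longest_path V P" "hd P \<in> A" "last P \<in> B"
      and mx: "\<And>P'. ?good P' \<Longrightarrow> ?w P' \<le> ?w P" by blast
    note m = square_case_mixed_ends[OF cV a b s free P mx]
    have ne: "P \<noteq> []" using longest_is_path[OF P(1)] by (simp add: is_path_def)
    have rh: "hd (rev Q) = last Q" "last (rev Q) = hd Q" if "Q \<noteq> []" for Q :: "'a list"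
      using that by (auto simp: hd_rev last_rev)
    have mx': "card (nbrs A (hd P')) + card (nbrs B (last P'))
        \<le> card (nbrs A (hd (rev P))) + card (nbrs B (last (rev P)))"
      if "longest_path V P'" "hd P' \<in> B" "last P' \<in> A" for P'
    proof -
      have "P' \<noteq> []" using longest_is_path[OF that(1)] by (simp add: is_path_def)
      then show ?thesis using mx[of "rev P'"] longest_rev[OF that(1)] that rh ne by simp
    qed
    have "pendant_structure (s - 2) B A"
      if "edge_count A B + 2 * s = s * s + 2" "card (nbrs A (last P)) = 1"
    proof (rule sw.square_case_mixed_ends(3)[unfolded BA, where P = "rev P"])
      show "longest_path V (rev P)" "hd (rev P) \<in> B" "last (rev P) \<in> A"
        using longest_rev[OF P(1)] P rh[OF ne] by auto
      show "card (nbrs A (hd (rev P))) = 1" using that rh[OF ne] by simp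
      show "edge_count B A + 2 * s = s * s + 2" using that ec by simp
    qed (use cV a b s free mx' in auto)
    then show ?thesis using m by blast
  qed
  have ?c
  proof (cases "hd P \<in> A")
    case h: True
    show ?thesis
    proof (cases "last P \<in> A")
      case True
      then show ?thesis using square_case_same_ends[OF cV a b s free P h] by blast
    next
      case False
      then show ?thesis using mixed[OF P h] is_path_ends[OF Pp] by blast
    qed
  next
    case False
    then have h: "hd P \<in> B" using is_path_ends[OF Pp] by blast
    show ?thesis
    proof (cases "last P \<in> A")
      case True
      have "P \<noteq> []" using Pp by (simp add: is_path_def)
      then show ?thesis using mixed[OF longest_rev[OF P]] True h by (simp add: hd_rev last_rev)
    next
      case False
      then have "last P \<in> B" using is_path_ends[OF Pp] by blast
      then show ?thesis
        using sw.square_case_same_ends[unfolded BA, OF cV b a s free P h] ec by auto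
    qed
  qed
  then show "edge_count A B + 2 * s \<le> s * s + 2"
    and "edge_count A B + 2 * s = s * s + 2 \<Longrightarrow>
      pendant_structure (s - 2) A B \<or> pendant_structure (s - 2) B A" by auto
qed

lemma outside_exists:
  assumes "is_path V P" "hd P \<in> A" "length P < 2 * s" "s \<le> card B"
  obtains u where "u \<in> B" "u \<notin> set P"
proof -
  have "card (set P \<inter> B) < card B" using card_path_less[OF assms(1-3)] assms(4) by simp
  then have "set P \<inter> B \<noteq> B" by auto
  then show ?thesis using that by blast
qed

lemma removable_pair:
  assumes cV: "conn V" and ab: "s \<le> card A" "card A = card B"
    and free: "\<And>xs. is_path V xs \<Longrightarrow> length xs < 2 * s"
    and P: "longest_path V P" "hd P \<in> A"
  shows "\<exists>x\<in>A. \<exists>z\<in>B. card (nbrs B x) + card (nbrs A z) < s \<and> conn (V - {z} - {x})"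
proof -
  have Pp: "is_path V P" using P(1) by (rule longest_is_path)
  have l: "length P div 2 < s" using free[OF Pp] by simp
  show ?thesis
  proof (cases "last P \<in> A")
    case True
    obtain z where "z \<in> B" "card (nbrs B (hd P)) + card (nbrs A z) \<le> length P div 2"
      "conn (V - {z} - {hd P})"
      using ends_same_pair[OF cV P True] ab by (metis order_refl)
    then show ?thesis using l P(2) by (meson le_less_trans)
  next
    case False
    then have y: "last P \<in> B" using is_path_ends[OF Pp] by blast
    obtain u where "u \<in> B" "u \<notin> set P"
      using outside_exists[OF Pp P(2) free[OF Pp]] ab by auto
    then have "set P \<noteq> V" by auto
    from ends_mixed_pair[OF cV P y this] show ?thesis using l P(2) y by (meson le_less_trans)
  qed
qed

text \<open>If an end of the longest path lies in \<open>A\<close>, its degree of at least 1 takes a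
  share of the degree sum \<open>s - 1\<close> and leaves at most \<open>s - 2\<close> for the
  vertex in \<open>B\<close>. If both ends lie in \<open>B\<close>, one end has this degree by
  itself.\<close>

lemma removable_vertex:
  assumes cV: "conn V" and ab: "s \<le> card A" "card A \<le> card B" "0 < s"
    and free: "\<And>xs. is_path V xs \<Longrightarrow> length xs < 2 * s"
  shows "\<exists>z\<in>B. card (nbrs A z) + 2 \<le> s \<and> conn (V - {z})"
proof -
  have BA: "B \<union> A = V" by auto
  interpret sw: bip R B A by (rule swapped)
  have "A \<noteq> {}" "B \<noteq> {}" using ab by auto
  then obtain P where P: "longest_path V P" using longest_ex[of V] by auto
  have Pp: "is_path V P" using P by (rule longest_is_path)
  have l: "length P div 2 < s" using free[OF Pp] by simp
  have deg: "card (nbrs B x) \<ge> 1" if "x \<in> A" for x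
  proof -
    obtain y where "y \<in> B" using \<open>B \<noteq> {}\<close> by blast
    then have "nbrs B x \<noteq> {}"
      using conn_nbr[OF cV, of x y] nbrs_A[OF that] that disj by auto
    then show ?thesis by (simp add: Suc_le_eq card_gt_0_iff)
  qed
  have mixed: ?thesis if P: "longest_path V P" "hd P \<in> A" "last P \<in> B" for P
  proof -
    have Pp: "is_path V P" using P(1) by (rule longest_is_path)
    have l: "length P div 2 < s" using free[OF Pp] by simp
    obtain u where "u \<in> B" "u \<notin> set P"
      using outside_exists[OF Pp P(2) free[OF Pp]] ab by auto
    then have "set P \<noteq> V" by auto
    note m = ends_mixed_pair[OF cV P this]
    have "card (nbrs A (last P)) + 2 \<le> s" using m(1) deg[OF P(2)] l by linarith
    then show ?thesis using m(4) P by blast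
  qed
  show ?thesis
  proof (cases "hd P \<in> A")
    case h: True
    show ?thesis
    proof (cases "last P \<in> A")
      case True
      obtain z where z: "z \<in> B" "card (nbrs B (hd P)) + card (nbrs A z) \<le> length P div 2"
        "conn (V - {z})"
        using ends_same_pair[OF cV P h True] ab by metis
      have "card (nbrs A z) + 2 \<le> s" using z deg[OF h] l by linarith
      then show ?thesis using z by blast
    next
      case False
      then show ?thesis using mixed[OF P h] is_path_ends[OF Pp] by blast
    qed
  next
    case False
    then have h: "hd P \<in> B" using is_path_ends[OF Pp] by blast
    show ?thesis
    proof (cases "last P \<in> A")
      case True
      have "P \<noteq> []" using Pp by (simp add: is_path_def)
      then show ?thesis using mixed[OF longest_rev[OF P]] True h by (simp add: hd_rev last_rev)
    next
      case False
      then have y: "last P \<in> B" using is_path_ends[OF Pp] by blast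
      obtain u where u: "u \<in> A" "u \<notin> set P"
        using sw.outside_exists[unfolded BA, OF Pp h free[OF Pp]] ab by auto
      note m = sw.ends_same_deg[unfolded BA, OF cV P h y u]
      have "card (nbrs A (hd P)) + 2 \<le> s" using m(1) l by linarith
      then show ?thesis using m(2) h by blast
    qed
  qed
qed

section \<open>Putting deleted vertices back into the extremal structure\<close>

lemma pendant_structure_add_vertex:
  assumes S: "pendant_structure t A (B - {z})" and z: "z \<in> B" "card (nbrs A z) = t" and t: "2 \<le> t"
    and ab: "t + 2 \<le> card A" "t + 2 \<le> card (B - {z})"
    and free: "\<And>M. is_path V M \<Longrightarrow> length M \<noteq> 2 * t + 4"
  shows "pendant_structure t A B"
proof -
  obtain T where T: "T \<subseteq> A" "card T = t" "\<And>x y. x \<in> T \<Longrightarrow> y \<in> B - {z} \<Longrightarrow> R x y"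
    and p: "\<And>x. x \<in> A - T \<Longrightarrow> card (nbrs (B - {z}) x) = 1"
    using S unfolding pendant_structure_def by blast
  have "card (A - T) = card A - t" using T finite_subset[OF T(1) finA] by (simp add: card_Diff_subset)
  moreover have "nbrs (B - {z}) x \<noteq> {}" if "x \<in> A - T" for x using p[OF that] by auto
  ultimately have nz: "nbrs A z = T"
    using T t ab z free by (intro new_vertex_nbrs) auto
  have "nbrs B x = nbrs (B - {z}) x" if "x \<in> A - T" for x
  proof -
    have "x \<notin> nbrs A z" using that nz by auto
    then have "\<not> R x z" using that sym by auto
    then show ?thesis by (auto simp: nbrs_def)
  qed
  moreover have "R x y" if "x \<in> T" "y \<in> B" for x y
  proof (cases "y = z")
    case True
    have "x \<in> nbrs A z" using nz that by simp
    then show ?thesis using True sym by auto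
  qed (use T that in auto)
  ultimately show ?thesis unfolding pendant_structure_def
    using T(1,2) p by (intro exI[of _ T]) auto
qed

text \<open>A vertex put back on the side of \<open>T\<close> must be pendant. This settles
  \<open>x\<close> when a pair is put back and, with the classes exchanged, excludes a structure of
  the wrong orientation.\<close>

lemma pendant_structure_two_nbrs:
  assumes S: "pendant_structure t (A - {x}) B" and x: "x \<in> A" "2 \<le> card (nbrs B x)" and t: "1 \<le> t"
    and ab: "t + 2 \<le> card (A - {x})" "t + 2 \<le> card B"
  shows "\<exists>M. is_path V M \<and> length M = 2 * t + 4"
proof -
  obtain T where T: "T \<subseteq> A - {x}" "card T = t" "\<And>x y. x \<in> T \<Longrightarrow> y \<in> B \<Longrightarrow> R x y"
    and p: "\<And>w. w \<in> A - {x} - T \<Longrightarrow> card (nbrs B w) = 1"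
    using S unfolding pendant_structure_def by blast
  have "\<not> A - {x} \<subseteq> T"
  proof
    assume "A - {x} \<subseteq> T"
    then have "A - {x} = T" using T(1) by auto
    then show False using T(2) ab by simp
  qed
  then obtain w where w: "w \<in> A - {x} - T" by blast
  obtain y where y: "nbrs B w = {y}" using p[OF w] by (auto simp: card_1_singleton_iff)
  then have yB: "y \<in> B" "R w y" by (auto simp: set_eq_iff)
  have "\<not> card (nbrs B x) \<le> Suc 0" using x(2) by simp
  then obtain y1 y2 where y12: "y1 \<in> nbrs B x" "y2 \<in> nbrs B x" "y1 \<noteq> y2"
    using card_le_Suc0_iff_eq[OF finite_nbrs[OF finB]] by blast
  have "T \<noteq> {}" using T t by auto
  then show ?thesis
    using long_path_two_nbrs[of T x y1 y2 w y] T ab x y12 w yB by auto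
qed

text \<open>\<open>x\<close> goes back first: more than one neighbour would create a long path, so
  it is pendant. The degree sum then leaves exactly \<open>t\<close> for \<open>z\<close>.\<close>

lemma pendant_structure_add_pair:
  assumes S: "pendant_structure t (A - {x}) (B - {z})" and xz: "x \<in> A" "z \<in> B" "\<not> R x z"
    and deg: "card (nbrs B x) + card (nbrs A z) = t + 1" "nbrs B x \<noteq> {}" and t: "2 \<le> t"
    and ab: "t + 2 \<le> card (A - {x})" "t + 2 \<le> card (B - {z})"
    and free: "\<And>M. is_path V M \<Longrightarrow> length M \<noteq> 2 * t + 4"
  shows "pendant_structure t A B"
proof -
  interpret m: bip R A "B - {z}" by (rule sub) auto
  have eq: "nbrs (B - {z}) x = nbrs B x" using xz by (auto simp: nbrs_def)
  have "\<not> 2 \<le> card (nbrs B x)"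
  proof
    assume "2 \<le> card (nbrs B x)"
    then obtain M where "is_path (A \<union> (B - {z})) M" "length M = 2 * t + 4"
      using m.pendant_structure_two_nbrs[OF S] xz t ab eq by auto
    then show False using free is_path_subset[of "A \<union> (B - {z})" M V] by blast
  qed
  moreover have "card (nbrs B x) > 0" using deg(2) by (simp add: card_gt_0_iff)
  ultimately have d: "card (nbrs B x) = 1" "card (nbrs A z) = t" using deg(1) by auto
  obtain T where T: "T \<subseteq> A - {x}" "card T = t" "\<And>x y. x \<in> T \<Longrightarrow> y \<in> B - {z} \<Longrightarrow> R x y"
    and p: "\<And>w. w \<in> A - {x} - T \<Longrightarrow> card (nbrs (B - {z}) w) = 1"
    using S unfolding pendant_structure_def by blast
  have "card (nbrs (B - {z}) w) = 1" if "w \<in> A - T" for w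
    using p[of w] that d eq by (cases "w = x") auto
  then have "pendant_structure t A (B - {z})"
    unfolding pendant_structure_def using T by (intro exI[of _ T]) auto
  moreover have "t + 2 \<le> card A" using ab(1) xz by simp
  ultimately show ?thesis using pendant_structure_add_vertex xz d t ab free by blast
qed

end

text \<open>\<open>bip R A B\<close> is a hypothesis here so that the classes can vary in the
  induction; the bound is written additively to avoid truncated subtraction.\<close>

lemma (in sym_graph) extremal:
  assumes "bip R A B" "conn (A \<union> B)" "2 \<le> t" "t + 2 \<le> card A" "card A \<le> card B"
    and "\<And>xs. is_path (A \<union> B) xs \<Longrightarrow> length xs < 2 * t + 4"
  shows "edge_count A B + t \<le> t * card B + card A \<and>
    (edge_count A B + t = t * card B + card A \<longrightarrow>
      pendant_structure t A B \<or> card A = card B \<and> pendant_structure t B A)"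
  using assms
proof (induction "card A + card B" arbitrary: A B rule: less_induct)
  case less
  interpret bip R A B by fact
  interpret sw: bip R B A by (rule swapped)
  have BA: "B \<union> A = V" by auto
  note cV = less.prems(2) and t = less.prems(3) and ta = less.prems(4) and ab = less.prems(5)
    and free = less.prems(6)
  have free': "length xs < 2 * (t + 2)" if "is_path V xs" for xs using free[OF that] by simp
  have freen: "length M \<noteq> 2 * t + 4" if "is_path V M" for M using free[OF that] by simp
  consider "card A < card B" | "card A = card B" "card A = t + 2" | "card A = card B" "t + 3 \<le> card A"
    using ta ab by linarith
  then show ?case
  proof cases
    case 1
    obtain z where z: "z \<in> B" "card (nbrs A z) \<le> t" "conn (V - {z})"
      using removable_vertex[OF cV ta ab _ free'] t by auto
    have cB: "card B = Suc (card (B - {z}))" using z by (metis card_Suc_Diff1 finB)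
    have Vz: "V - {z} = A \<union> (B - {z})" using z disj by auto
    have ec: "edge_count A B = card (nbrs A z) + edge_count A (B - {z})"
      using z by (intro edge_count_remove_right) auto
    have IH: "edge_count A (B - {z}) + t \<le> t * card (B - {z}) + card A \<and>
      (edge_count A (B - {z}) + t = t * card (B - {z}) + card A \<longrightarrow>
        pendant_structure t A (B - {z}) \<or> card A = card (B - {z}) \<and> pendant_structure t (B - {z}) A)"
    proof (rule less.hyps)
      show "card A + card (B - {z}) < card A + card B" using cB by simp
      show "bip R A (B - {z})" by (rule sub) auto
      show "length xs < 2 * t + 4" if "is_path (A \<union> (B - {z})) xs" for xs
        using that is_path_subset[of "A \<union> (B - {z})" xs V] by (intro free) auto
      show "conn (A \<union> (B - {z}))" using z(3) unfolding Vz .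
      show "card A \<le> card (B - {z})" using 1 cB by simp
    qed (fact t ta)+
    have mul: "t * card B = t + t * card (B - {z})" using cB by simp
    show ?thesis
    proof (intro conjI impI)
      show "edge_count A B + t \<le> t * card B + card A" using IH ec z(2) mul by linarith
      assume eq: "edge_count A B + t = t * card B + card A"
      then have dz: "card (nbrs A z) = t" and "edge_count A (B - {z}) + t = t * card (B - {z}) + card A"
        using IH ec z(2) mul by linarith+
      then consider "pendant_structure t A (B - {z})"
        | "pendant_structure t (B - {z}) A" using IH by blast
      then show "pendant_structure t A B \<or> card A = card B \<and> pendant_structure t B A"
      proof cases
        case S: 1
        have "t + 2 \<le> card (B - {z})" using ta 1 cB by simp
        then show ?thesis using pendant_structure_add_vertex[OF S z(1) dz t ta _ freen] by blast
      next
        case S: 2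
        \<comment> \<open>The wrong orientation can occur only when
          \<open>card A = card B - 1\<close>. Then \<open>z\<close> joins the side of the
          \<open>t\<close> full vertices with degree \<open>t \<ge> 2\<close>, and a path on
          \<open>2 * t + 4\<close> vertices appears.\<close>
        have "t + 2 \<le> card (B - {z})" using ta 1 cB by simp
        then obtain M where "is_path V M" "length M = 2 * t + 4"
          using sw.pendant_structure_two_nbrs[unfolded BA, OF S z(1)] dz t ta by auto
        then show ?thesis using freen by blast
      qed
    qed
  next
    case 2
    have s4: "4 \<le> t + 2" using t by simp
    have cB: "card B = t + 2" using 2 by simp
    note sq = square_case[OF cV 2(2) cB s4 free']
    have ar: "(t + 2) * (t + 2) + 2 + t = t * card B + card A + 2 * (t + 2)"
      unfolding cB 2(2) by (simp add: algebra_simps)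
    show ?thesis
    proof (intro conjI impI)
      show "edge_count A B + t \<le> t * card B + card A" using sq(1) ar by linarith
      assume "edge_count A B + t = t * card B + card A"
      then have "edge_count A B + 2 * (t + 2) = (t + 2) * (t + 2) + 2" using ar by linarith
      then show "pendant_structure t A B \<or> card A = card B \<and> pendant_structure t B A"
        using sq(2) 2 by simp
    qed
  next
    case 3
    have ne: "A \<noteq> {}" "B \<noteq> {}" using 3 by auto
    then obtain P where P: "longest_path V P" using longest_ex[of V] by auto
    have "\<exists>x\<in>A. \<exists>z\<in>B. card (nbrs B x) + card (nbrs A z) < t + 2 \<and> conn (V - {x, z})"
    proof (cases "hd P \<in> A")
      case True
      then obtain x z where "x \<in> A" "z \<in> B" "card (nbrs B x) + card (nbrs A z) < t + 2" "conn (V - {z} - {x})"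
        using removable_pair[OF cV ta 3(1) free' P] by blast
      moreover have "V - {z} - {x} = V - {x, z}" by auto
      ultimately show ?thesis by auto
    next
      case False
      then have "hd P \<in> B" using is_path_ends[OF longest_is_path[OF P]] by blast
      then obtain x z where "x \<in> B" "z \<in> A" "card (nbrs A x) + card (nbrs B z) < t + 2" "conn (V - {z} - {x})"
        using sw.removable_pair[unfolded BA, OF cV _ 3(1)[symmetric] free' P] ta 3 by auto
      moreover have "V - {z} - {x} = V - {z, x}" by auto
      ultimately show ?thesis by (metis add.commute)
    qed
    then obtain x z where xz: "x \<in> A" "z \<in> B" and deg: "card (nbrs B x) + card (nbrs A z) \<le> t + 1"
      and con: "conn (V - {x, z})" by fastforce
    have cA: "card A = Suc (card (A - {x}))" using xz by (metis card_Suc_Diff1 finA)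
    have cB: "card B = Suc (card (B - {z}))" using xz by (metis card_Suc_Diff1 finB)
    have Vz: "V - {x, z} = (A - {x}) \<union> (B - {z})" using xz disj by auto
    \<comment> \<open>An edge between \<open>x\<close> and \<open>z\<close> is counted with
      \<open>z\<close> only. Equality in the bound therefore forces \<open>x\<close> and
      \<open>z\<close> to be non-adjacent.\<close>
    have ec: "edge_count A B = card (nbrs A z) + (card (nbrs (B - {z}) x) + edge_count (A - {x}) (B - {z}))"
      using xz edge_count_remove_right[of A B z] edge_count_remove_left[of A x "B - {z}"] by simp
    have IH: "edge_count (A - {x}) (B - {z}) + t \<le> t * card (B - {z}) + card (A - {x}) \<and>
      (edge_count (A - {x}) (B - {z}) + t = t * card (B - {z}) + card (A - {x}) \<longrightarrow>
        pendant_structure t (A - {x}) (B - {z}) \<or>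
        card (A - {x}) = card (B - {z}) \<and> pendant_structure t (B - {z}) (A - {x}))"
    proof (rule less.hyps)
      show "card (A - {x}) + card (B - {z}) < card A + card B" using cA cB by simp
      show "bip R (A - {x}) (B - {z})" by (rule sub) auto
      show "length xs < 2 * t + 4" if "is_path ((A - {x}) \<union> (B - {z})) xs" for xs
        using that is_path_subset[of "(A - {x}) \<union> (B - {z})" xs V] by (intro free) auto
      show "conn ((A - {x}) \<union> (B - {z}))" using con unfolding Vz .
      show "t + 2 \<le> card (A - {x})" "card (A - {x}) \<le> card (B - {z})" using 3 cA cB by auto
    qed (fact t)
    have mul: "t * card B = t + t * card (B - {z})" using cB by simp
    have le: "card (nbrs (B - {z}) x) \<le> card (nbrs B x)" by (intro card_mono) auto
    show ?thesis
    proof (intro conjI impI)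
      show "edge_count A B + t \<le> t * card B + card A" using IH ec deg le mul cA by linarith
      assume eq: "edge_count A B + t = t * card B + card A"
      then have d1: "card (nbrs B x) + card (nbrs A z) = t + 1" and d2: "card (nbrs (B - {z}) x) = card (nbrs B x)"
        and "edge_count (A - {x}) (B - {z}) + t = t * card (B - {z}) + card (A - {x})"
        using IH ec deg le mul cA by linarith+
      then consider "pendant_structure t (A - {x}) (B - {z})" | "pendant_structure t (B - {z}) (A - {x})"
        using IH by blast
      note S = this
      have "nbrs (B - {z}) x = nbrs B x" using d2 by (intro card_subset_eq) auto
      then have nxz: "\<not> R x z" using xz by (auto simp: set_eq_iff)
      then have nzx: "\<not> R z x" using sym by blast
      have xz': "x \<noteq> z" using xz disj by auto
      have nx: "nbrs B x \<noteq> {}" using conn_nbr[OF cV, of x z] xz xz' nbrs_A[of x] by auto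
      have nz: "nbrs A z \<noteq> {}" using conn_nbr[OF cV, of z x] xz xz' nbrs_B[of z] by auto
      have sz: "t + 2 \<le> card (A - {x})" "t + 2 \<le> card (B - {z})" using 3 cA cB by auto
      from S show "pendant_structure t A B \<or> card A = card B \<and> pendant_structure t B A"
      proof cases
        case 1
        then show ?thesis using pendant_structure_add_pair[OF 1 xz nxz d1 nx t sz freen] by blast
      next
        case 2
        have "card (nbrs A z) + card (nbrs B x) = t + 1" using d1 by simp
        then show ?thesis
          using sw.pendant_structure_add_pair[unfolded BA, OF 2 xz(2,1) nzx _ nz t sz(2,1) freen] 3 by blast
      qed
    qed
  qed
qed

section \<open>Translation to graphs\<close>

lemma t_par_eq: "3 \<le> k \<Longrightarrow> t_par k = (k - 3) div 2"
  unfolding t_par_def using floor_divide_of_nat_eq[of "k - 3" 2, where 'a = real]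
  by simp

lemma pendant_extension_edge_iff:
  "{Inl i, Inr j} \<in> edges (pendant_extension t a b f) \<longleftrightarrow>
     (i < t \<and> j < b) \<or> (t \<le> i \<and> i < a \<and> j = f i)"
  "{Inr j, Inl i} \<in> edges (pendant_extension t a b f) \<longleftrightarrow>
     (i < t \<and> j < b) \<or> (t \<le> i \<and> i < a \<and> j = f i)"
  "{Inl i, Inl i'} \<notin> edges (pendant_extension t a b f)"
  "{Inr j, Inr j'} \<notin> edges (pendant_extension t a b f)"
  by (auto simp: pendant_extension_def complete_bipartite_def doubleton_eq_iff)

lemma pendant_extension_verts: "t \<le> a \<Longrightarrow>
  verts (pendant_extension t a b f) = Inl ` {..<a} \<union> Inr ` {..<b}"
  by (auto simp: pendant_extension_def complete_bipartite_def image_iff)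

lemma pendant_extension_cong:
  "(\<And>i. t \<le> i \<Longrightarrow> i < a \<Longrightarrow> f i = g i) \<Longrightarrow> pendant_extension t a b f = pendant_extension t a b g"
  by (auto simp: pendant_extension_def)

lemma pendant_extension_simple:
  assumes "\<And>i. i \<in> {t..<a} \<Longrightarrow> f i < b" "t \<le> a"
  shows "simple_graph (pendant_extension t a b f)"
  unfolding simple_graph_def pendant_extension_verts[OF assms(2)]
  using assms by (auto simp: pendant_extension_def complete_bipartite_def)

lemma pendant_extension_card_edges:
  assumes "t \<le> a"
  shows "card (edges (pendant_extension t a b f)) = t * b + (a - t)"
proof -
  let ?g = "\<lambda>(i, j). {Inl i, Inr j} :: (nat + nat) set"
  have e: "edges (pendant_extension t a b f) = ?g ` ({..<t} \<times> {..<b}) \<union> ?g ` ((\<lambda>i. (i, f i)) ` {t..<a})"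
    by (auto simp: pendant_extension_def complete_bipartite_def)
  have inj: "inj ?g" by (auto simp: inj_def doubleton_eq_iff)
  have "card (edges (pendant_extension t a b f)) = card ({..<t} \<times> {..<b} \<union> (\<lambda>i. (i, f i)) ` {t..<a})"
    unfolding e image_Un[symmetric] by (rule card_image[OF inj_on_subset[OF inj]]) simp
  also have "\<dots> = card ({..<t} \<times> {..<b}) + card ((\<lambda>i. (i, f i)) ` {t..<a})"
    by (rule card_Un_disjoint) auto
  also have "card ((\<lambda>i. (i, f i)) ` {t..<a}) = a - t"
    by (subst card_image) (auto simp: inj_on_def)
  finally show ?thesis by (simp add: card_cartesian_product)
qed

lemma graph_iso_card_edges:
  assumes G: "simple_graph G" and H: "simple_graph H" and iso: "G \<simeq>\<^sub>g H"
  shows "card (edges G) = card (edges H)"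
proof -
  obtain f where f: "bij_betw f (verts G) (verts H)"
    and e: "\<And>u v. u \<in> verts G \<Longrightarrow> v \<in> verts G \<Longrightarrow> {u, v} \<in> edges G \<longleftrightarrow> {f u, f v} \<in> edges H"
    using iso unfolding graph_iso_def by blast
  have inj: "inj_on f (verts G)" and surj: "f ` verts G = verts H"
    using f by (auto simp: bij_betw_def)
  have "inj_on ((`) f) (edges G)"
    using inj_on_image_Pow[OF inj] by (rule inj_on_subset) (use G in \<open>auto simp: simple_graph_def\<close>)
  moreover have "(`) f ` edges G = edges H"
  proof
    show "(`) f ` edges G \<subseteq> edges H"
    proof
      fix x assume "x \<in> (`) f ` edges G"
      then obtain d where d: "d \<in> edges G" "x = f ` d" by blast
      then obtain u v where "d = {u, v}" "d \<subseteq> verts G" using G by (auto simp: simple_graph_def card_2_iff)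
      then show "x \<in> edges H" using d e[of u v] by auto
    qed
    show "edges H \<subseteq> (`) f ` edges G"
    proof
      fix x assume x: "x \<in> edges H"
      then obtain p q where pq: "x = {p, q}" "p \<in> verts H" "q \<in> verts H"
        using H by (auto simp: simple_graph_def card_2_iff)
      then obtain u v where "u \<in> verts G" "v \<in> verts G" "p = f u" "q = f v" using surj by blast
      then have "{u, v} \<in> edges G" "x = f ` {u, v}" using e x pq by auto
      then show "x \<in> (`) f ` edges G" by blast
    qed
  qed
  ultimately show ?thesis using card_image by metis
qed

lemma list_path_not_path_free:
  assumes G: "simple_graph G" and xs: "distinct xs" "set xs \<subseteq> verts G"
    and succ: "successively (\<lambda>x y. {x, y} \<in> edges G) xs"
  shows "\<not> path_free (length xs) G"
proof -
  let ?k = "length xs"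
  define H where "H = \<lparr>verts = set xs, edges = {{xs ! i, xs ! Suc i} | i. Suc i < ?k}\<rparr>"
  have "{xs ! i, xs ! Suc i} \<in> edges G" if "Suc i < ?k" for i
    using succ that by (simp add: successively_conv_nth)
  moreover have "card {xs ! i, xs ! Suc i} = 2" if "Suc i < ?k" for i
    using xs(1) that by (simp add: nth_eq_iff_index_eq)
  ultimately have sub: "subgraph H G"
    using xs by (auto simp: subgraph_def simple_graph_def H_def)
  have bij: "bij_betw ((!) xs) {..<?k} (set xs)"
    using xs(1) by (rule bij_betw_nth) auto
  define g where "g = the_inv_into {..<?k} ((!) xs)"
  have bg: "bij_betw g (set xs) {..<?k}" unfolding g_def by (rule bij_betw_the_inv_into[OF bij])
  have gx: "g (xs ! i) = i" if "i < ?k" for i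
    unfolding g_def using bij that by (intro the_inv_into_f_f) (auto simp: bij_betw_def)
  have "H \<simeq>\<^sub>g path_graph ?k"
    unfolding graph_iso_def
  proof (intro exI[of _ g] conjI ballI)
    show "bij_betw g (verts H) (verts (path_graph ?k))" using bg by (simp add: H_def path_graph_def)
    fix u v assume "u \<in> verts H" "v \<in> verts H"
    then obtain i j where ij: "i < ?k" "j < ?k" "u = xs ! i" "v = xs ! j"
      by (auto simp: H_def in_set_conv_nth)
    have "{u, v} \<in> edges H \<longleftrightarrow> j = Suc i \<or> i = Suc j"
      using ij xs(1) by (auto simp: H_def doubleton_eq_iff nth_eq_iff_index_eq)
    moreover have "{g u, g v} \<in> edges (path_graph ?k) \<longleftrightarrow> j = Suc i \<or> i = Suc j"
      using ij gx by (auto simp: path_graph_def doubleton_eq_iff)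
    ultimately show "{u, v} \<in> edges H \<longleftrightarrow> {g u, g v} \<in> edges (path_graph ?k)" by simp
  qed
  then show ?thesis using sub by (auto simp: path_free_def)
qed

definition adjacent :: "'a ugraph \<Rightarrow> 'a \<Rightarrow> 'a \<Rightarrow> bool" where
  "adjacent G x y \<longleftrightarrow> {x, y} \<in> edges G"

lemma bip_adjacent:
  assumes "simple_graph G" "bipartition G A B"
  shows "bip (adjacent G) A B"
proof
  have V: "A \<union> B = verts G" and d: "A \<inter> B = {}"
    and e: "\<And>e. e \<in> edges G \<Longrightarrow> \<exists>x\<in>A. \<exists>y\<in>B. e = {x, y}"
    using assms(2) by (auto simp: bipartition_def)
  have "finite (A \<union> B)" using assms(1) V by (simp add: simple_graph_def)
  then show "finite A" "finite B" by auto
  show "A \<inter> B = {}" by fact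
  show "adjacent G y x" if "adjacent G x y" for x y using that by (simp add: adjacent_def insert_commute)
  show "\<not> adjacent G x y" if "x \<in> A" "y \<in> A" for x y
    using that e[of "{x, y}"] d by (auto simp: adjacent_def doubleton_eq_iff)
  show "\<not> adjacent G x y" if "x \<in> B" "y \<in> B" for x y
    using that e[of "{x, y}"] d by (auto simp: adjacent_def doubleton_eq_iff)
qed

text \<open>The numbering \<open>hB\<close> is a parameter and the range of \<open>f\<close> is
  recorded, so that a common neighbour of the pendant vertices can later be given the number
  0.\<close>

lemma pendant_structure_iso:
  assumes G: "simple_graph G" "bipartition G A B"
    and T: "T \<subseteq> A" "card T = t" "\<And>x y. x \<in> T \<Longrightarrow> y \<in> B \<Longrightarrow> {x, y} \<in> edges G"
    and n: "\<And>x y. x \<in> A - T \<Longrightarrow> y \<in> B \<Longrightarrow> {x, y} \<in> edges G \<longleftrightarrow> y = n x"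
    and nB: "\<And>x. x \<in> A - T \<Longrightarrow> n x \<in> B"
    and a: "card A = a" and hB: "bij_betw hB B {..<b}"
  shows "\<exists>f. (\<forall>i\<in>{t..<a}. f i \<in> hB ` n ` (A - T)) \<and> G \<simeq>\<^sub>g pendant_extension t a b f"
proof -
  interpret bip "adjacent G" A B by (rule bip_adjacent[OF G])
  have V: "verts G = A \<union> B" using G(2) by (simp add: bipartition_def)
  have fT: "finite T" using T(1) finA by (rule finite_subset)
  have ta: "t \<le> a" using card_mono[OF finA T(1)] T a by simp
  have "card T = card {..<t}" using T by simp
  then obtain h1 where h1: "bij_betw h1 T {..<t}" using fT finite_same_card_bij by blast
  have "card (A - T) = card {t..<a}" using T a fT by (simp add: card_Diff_subset)
  then obtain h2 where h2: "bij_betw h2 (A - T) {t..<a}"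
    using finite_same_card_bij[of "A - T" "{t..<a}"] by auto
  define h where "h v = (if v \<in> T then h1 v else h2 v)" for v
  have h1': "bij_betw h T {..<t}" using h1 by (rule bij_betw_cong[THEN iffD1, rotated]) (simp add: h_def)
  have h2': "bij_betw h (A - T) {t..<a}" using h2 by (rule bij_betw_cong[THEN iffD1, rotated]) (simp add: h_def)
  have "bij_betw h (T \<union> (A - T)) ({..<t} \<union> {t..<a})"
    by (rule bij_betw_combine[OF h1' h2']) auto
  moreover have "T \<union> (A - T) = A" "{..<t} \<union> {t..<a} = {..<a}" using T(1) ta by auto
  ultimately have hA: "bij_betw h A {..<a}" by simp
  define f where "f i = hB (n (the_inv_into (A - T) h i))" for i
  have fh: "f (h x) = hB (n x)" if "x \<in> A - T" for x
    unfolding f_def using h2' that by (simp add: the_inv_into_f_f bij_betw_def)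
  define F where "F v = (if v \<in> A then Inl (h v) else Inr (hB v))" for v
  have FA: "F v = Inl (h v)" if "v \<in> A" for v using that by (simp add: F_def)
  have FB: "F v = Inr (hB v)" if "v \<in> B" for v using that disj by (auto simp: F_def)
  have "bij_betw F A (Inl ` {..<a})"
    using hA FA by (auto simp: bij_betw_def inj_on_def image_def)
  moreover have "bij_betw F B (Inr ` {..<b})"
    using hB FB by (auto simp: bij_betw_def inj_on_def image_def)
  ultimately have bF: "bij_betw F (A \<union> B) (Inl ` {..<a} \<union> Inr ` {..<b})"
    by (rule bij_betw_combine) auto
  have key: "{x, y} \<in> edges G \<longleftrightarrow> {Inl (h x), Inr (hB y)} \<in> edges (pendant_extension t a b f)"
    if "x \<in> A" "y \<in> B" for x y
  proof (cases "x \<in> T")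
    case True
    then have "h x < t" "hB y < b" using h1' hB that by (auto simp: bij_betw_def)
    then show ?thesis using T(3)[OF True that(2)] by (simp add: pendant_extension_edge_iff)
  next
    case False
    then have x: "x \<in> A - T" using that by simp
    have hx: "t \<le> h x" "h x < a" using h2' x by (auto simp: bij_betw_def)
    have "hB y = hB (n x) \<longleftrightarrow> y = n x" using hB that nB[OF x] by (auto simp: bij_betw_def inj_on_def)
    then show ?thesis using n[OF x that(2)] hx fh[OF x] by (simp add: pendant_extension_edge_iff)
  qed
  have "G \<simeq>\<^sub>g pendant_extension t a b f"
    unfolding graph_iso_def
  proof (intro exI[of _ F] conjI ballI)
    show "bij_betw F (verts G) (verts (pendant_extension t a b f))"
      using bF V pendant_extension_verts[OF ta] by simp
    fix u v assume uv: "u \<in> verts G" "v \<in> verts G"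
    consider "u \<in> A" "v \<in> B" | "u \<in> B" "v \<in> A" | "u \<in> A" "v \<in> A" | "u \<in> B" "v \<in> B"
      using uv V by blast
    then show "{u, v} \<in> edges G \<longleftrightarrow> {F u, F v} \<in> edges (pendant_extension t a b f)"
    proof cases
      case 1 then show ?thesis using key[OF 1] FA FB by simp
    next
      case 2 then show ?thesis using key[OF 2(2,1)] FA FB by (simp add: insert_commute)
    next
      case 3 then show ?thesis using indepA[OF 3] FA by (simp add: pendant_extension_edge_iff adjacent_def)
    next
      case 4 then show ?thesis using indepB[OF 4] FB by (simp add: pendant_extension_edge_iff adjacent_def)
    qed
  qed
  moreover have "f i \<in> hB ` n ` (A - T)" if "i \<in> {t..<a}" for i
  proof -
    have "i \<in> h ` (A - T)" using h2' that by (simp add: bij_betw_def)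
    then show ?thesis using fh by auto
  qed
  ultimately show ?thesis by blast
qed

lemma pendant_structure_graph:
  assumes G: "simple_graph G" "bipartition G A B" and a: "card A = a" and b: "card B = b"
    and S: "sym_graph.pendant_structure (adjacent G) t A B"
    and t: "1 \<le> t" "t + 2 \<le> b" "t < a"
  shows "\<exists>f. (\<forall>i\<in>{t..<a}. f i < b) \<and> G \<simeq>\<^sub>g pendant_extension t a b f"
    and "(\<And>xs. sym_graph.is_path (adjacent G) (A \<union> B) xs \<Longrightarrow> length xs < 2 * t + 3) \<Longrightarrow>
      G \<simeq>\<^sub>g pendant_extension t a b (\<lambda>_. 0)"
proof -
  interpret bip "adjacent G" A B by (rule bip_adjacent[OF G])
  obtain T where T: "T \<subseteq> A" "card T = t" "\<And>x y. x \<in> T \<Longrightarrow> y \<in> B \<Longrightarrow> adjacent G x y"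
    and p: "\<And>x. x \<in> A - T \<Longrightarrow> card (nbrs B x) = 1"
    using S unfolding pendant_structure_def by blast
  have fT: "finite T" using T(1) finA by (rule finite_subset)
  define n where "n x = the_elem (nbrs B x)" for x
  have n: "nbrs B x = {n x}" if "x \<in> A - T" for x
  proof -
    obtain y where "nbrs B x = {y}" using p[OF \<open>x \<in> A - T\<close>] by (rule card_1_singletonE)
    then show ?thesis by (simp add: n_def)
  qed
  have nB: "n x \<in> B" "adjacent G x (n x)" if "x \<in> A - T" for x using n[OF that] by (auto simp: set_eq_iff)
  have n': "{x, y} \<in> edges G \<longleftrightarrow> y = n x" if "x \<in> A - T" "y \<in> B" for x y
    using n[OF that(1)] that(2) by (auto simp: set_eq_iff adjacent_def)
  have T3: "{x, y} \<in> edges G" if "x \<in> T" "y \<in> B" for x y using T(3)[OF that] by (simp add: adjacent_def)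
  have iso: "\<exists>f. (\<forall>i\<in>{t..<a}. f i \<in> h ` n ` (A - T)) \<and> G \<simeq>\<^sub>g pendant_extension t a b f"
    if "bij_betw h B {..<b}" for h
    using T3 n' nB(1) a that by (intro pendant_structure_iso[OF G T(1,2)]) auto
  have "card B = card {..<b}" using b by simp
  then obtain hB where hB: "bij_betw hB B {..<b}" using finite_same_card_bij[of B "{..<b}"] by auto
  obtain f where f: "\<forall>i\<in>{t..<a}. f i \<in> hB ` n ` (A - T)" "G \<simeq>\<^sub>g pendant_extension t a b f"
    using iso[OF hB] by blast
  have "f i < b" if "i \<in> {t..<a}" for i
  proof -
    have "f i \<in> hB ` B" using f(1) that nB by blast
    then show ?thesis using hB by (auto simp: bij_betw_def)
  qed
  then show "\<exists>f. (\<forall>i\<in>{t..<a}. f i < b) \<and> G \<simeq>\<^sub>g pendant_extension t a b f" using f(2) by blast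
  assume free: "\<And>xs. is_path (A \<union> B) xs \<Longrightarrow> length xs < 2 * t + 3"
  \<comment> \<open>Two pendant vertices with different neighbours are the ends of a path through
    all of \<open>T\<close>, on \<open>2 + 2 + 2 * t - 1\<close> vertices; this is \<open>k\<close>
    when \<open>k\<close> is odd.\<close>
  have same: "n x = n x'" if x: "x \<in> A - T" "x' \<in> A - T" for x x'
  proof (rule ccontr)
    assume ne: "n x \<noteq> n x'"
    obtain v where v: "v \<in> T" using T(2) t by fastforce
    note nx = nB[OF x(1)] nB[OF x(2)]
    have nd: "x \<noteq> n x" "x' \<noteq> n x'" "x \<noteq> n x'" "x' \<noteq> n x" "n x \<notin> T" "n x' \<notin> T"
      using x nx disj T(1) by auto
    have "card B - card {n x, n x'} \<le> card (B - {n x, n x'})"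
      by (rule diff_card_le_card_Diff) simp
    moreover have "B - set [x, n x] - set [n x', x'] = B - {n x, n x'}" using x disj by auto
    ultimately have c: "card T \<le> card (B - set [x, n x] - set [n x', x']) + 1" using ne t b T(2) by simp
    have xx: "x \<noteq> x'" using ne by auto
    have "\<exists>M. is_path V M \<and> length M + 1 = length [x, n x] + length [n x', x'] + 2 * card T"
    proof (rule zigzag_path[of T B V v, OF fT finB _ _ _ _ v])
      show "is_path V [x, n x]" "is_path V [n x', x']"
        using x nx nd sym[OF nx(2)] sym[OF nx(4)] by (auto simp: is_path_def)
      show "adjacent G (last [x, n x]) v" using sym[OF T(3)[OF v nx(1)]] by simp
      show "adjacent G u y" if "u \<in> T" "y \<in> B" for u y using that by (rule T(3))
      show "T \<subseteq> V" "T \<inter> B = {}" using T(1) disj by auto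
    qed (use x nx nd ne xx c in auto)
    then obtain M where "is_path V M" "length M = 2 * t + 3" using T(2) by auto
    then show False using free[of M] by simp
  qed
  have "A - T \<noteq> {}" using T(1,2) a t(3) by auto
  then obtain x0 where x0: "x0 \<in> A - T" by blast
  let ?y = "n x0"
  have y0: "?y \<in> B" by (rule nB(1)[OF x0])
  have "card (B - {?y}) = card {1..<b}" using b y0 by simp
  then obtain g where g: "bij_betw g (B - {?y}) {1..<b}"
    using finite_same_card_bij[of "B - {?y}" "{1..<b}"] by auto
  \<comment> \<open>\<open>B\<close> is numbered afresh so that the common neighbour gets the number
    0 fixed in \<open>B1_graph\<close>.\<close>
  define h where "h v = (if v = ?y then 0 else g v)" for v
  have "bij_betw h (B - {?y}) {1..<b}" using g by (rule bij_betw_cong[THEN iffD1, rotated]) (simp add: h_def)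
  moreover have "bij_betw h {?y} {0}" by (simp add: bij_betw_def h_def)
  ultimately have "bij_betw h ((B - {?y}) \<union> {?y}) ({1..<b} \<union> {0})"
    by (rule bij_betw_combine) auto
  moreover have "(B - {?y}) \<union> {?y} = B" "{1..<b} \<union> {0} = {..<b}" using y0 t by auto
  ultimately have h: "bij_betw h B {..<b}" by simp
  obtain f where f: "\<forall>i\<in>{t..<a}. f i \<in> h ` n ` (A - T)" "G \<simeq>\<^sub>g pendant_extension t a b f"
    using iso[OF h] by blast
  have "n ` (A - T) = {?y}" using same x0 by blast
  then have "pendant_extension t a b f = pendant_extension t a b (\<lambda>_. 0)"
    using f(1) by (intro pendant_extension_cong) (auto simp: h_def)
  then show "G \<simeq>\<^sub>g pendant_extension t a b (\<lambda>_. 0)" using f(2) by simp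
qed

lemma card_edges_bipartition:
  assumes G: "simple_graph G" "bipartition G A B"
  shows "card (edges G) = sym_graph.edge_count (adjacent G) A B"
proof -
  interpret bip "adjacent G" A B by (rule bip_adjacent[OF G])
  let ?g = "\<lambda>(x, y). {x, y}"
  have "edges G = ?g ` (SIGMA x:A. nbrs B x)"
    using G(2) by (fastforce simp: bipartition_def adjacent_def image_iff)
  moreover have "inj_on ?g (SIGMA x:A. nbrs B x)"
    using disj by (auto simp: inj_on_def doubleton_eq_iff)
  ultimately have "card (edges G) = card (SIGMA x:A. nbrs B x)" by (simp add: card_image)
  then show ?thesis by (simp add: edge_count_def)
qed

theorem theorem2:
  fixes G :: "'a ugraph" and A B :: "'a set" and a b k t :: nat
  assumes "simple_graph G"
    and "connected_graph G"
    and "bipartition G A B"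
    and "card A = a" and "card B = b"
    and "b \<ge> a" and "real a \<ge> real k / 2" and "real k / 2 \<ge> 4"
    and "path_free k G"
    and "t = t_par k"
  shows "int (card (edges G)) \<le> int t * int b + (int a - int t) \<and>
    (odd k \<longrightarrow>
       (int (card (edges G)) = int t * int b + (int a - int t) \<longleftrightarrow> G \<simeq>\<^sub>g B1_graph a b k)) \<and>
    (even k \<longrightarrow>
       (int (card (edges G)) = int t * int b + (int a - int t) \<longleftrightarrow>
          (\<exists>H\<in>B1_family a b k. G \<simeq>\<^sub>g H)))"
proof -
  note G = assms(1,3) and a = assms(4) and b = assms(5) and ab = assms(6) and tk = assms(10)
  interpret bip "adjacent G" A B by (rule bip_adjacent[OF G])
  have k8: "8 \<le> k" using assms(8) by simp
  have ak: "k \<le> 2 * a" using assms(7) by simp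
  have t: "t = (k - 3) div 2" using tk t_par_eq[of k] k8 by simp
  have even: "k = 2 * t + 4" if "even k" using that t k8 by presburger
  have odd: "k = 2 * t + 3" if "odd k" using that t k8 by presburger
  have t2: "2 \<le> t" using t k8 by linarith
  have ta: "t + 2 \<le> a" using ak even odd by (cases "even k") presburger+
  have V: "A \<union> B = verts G" using G(2) by (simp add: bipartition_def)
  have free: "length xs < k" if xs: "is_path V xs" for xs
  proof (rule ccontr)
    assume "\<not> length xs < k"
    \<comment> \<open>A path with more than \<open>k\<close> vertices is cut down to one with
      exactly \<open>k\<close>.\<close>
    then have l: "length (take k xs) = k" by simp
    have "is_path V (take k xs)" using xs k8 by (intro is_path_take) auto
    then have p: "distinct (take k xs)" "set (take k xs) \<subseteq> verts G" "successively (adjacent G) (take k xs)"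
      unfolding is_path_def V by blast+
    have "adjacent G = (\<lambda>x y. {x, y} \<in> edges G)" by (simp add: fun_eq_iff adjacent_def)
    then show False using list_path_not_path_free[OF G(1) p(1,2)] p(3) l assms(9) by simp
  qed
  have kt: "k \<le> 2 * t + 4" using even odd by (cases "even k") auto
  have sw_free: "is_path (B \<union> A) xs \<Longrightarrow> is_path V xs" for xs by (simp add: Un_commute)
  have "conn V"
    unfolding conn_def
  proof (intro ballI)
    fix u v assume "u \<in> V" "v \<in> V"
    then have "(\<lambda>x y. {x, y} \<in> edges G)\<^sup>*\<^sup>* u v"
      using assms(2) V by (simp add: connected_graph_def)
    moreover have "(\<lambda>x y. {x, y} \<in> edges G) = (\<lambda>x y. adjacent G x y \<and> x \<in> V \<and> y \<in> V)"
    proof (intro ext iffI)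
      fix x y assume e: "{x, y} \<in> edges G"
      then have "{x, y} \<subseteq> verts G" using G(1) by (auto simp: simple_graph_def)
      then show "adjacent G x y \<and> x \<in> V \<and> y \<in> V" using e V by (auto simp: adjacent_def)
    qed (simp add: adjacent_def)
    ultimately show "reach V u v" by (simp add: reach_def)
  qed
  moreover have "length xs < 2 * t + 4" if "is_path V xs" for xs using free[OF that] kt by simp
  ultimately have ex: "edge_count A B + t \<le> t * card B + card A \<and>
    (edge_count A B + t = t * card B + card A \<longrightarrow>
      pendant_structure t A B \<or> card A = card B \<and> pendant_structure t B A)"
    using extremal[of A B t] bip_adjacent[OF G] t2 ta a b ab by blast
  have ec: "card (edges G) = edge_count A B" by (rule card_edges_bipartition[OF G])
  have arith: "int (card (edges G)) \<le> int t * int b + (int a - int t) \<longleftrightarrow> edge_count A B + t \<le> t * b + a"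
    "int (card (edges G)) = int t * int b + (int a - int t) \<longleftrightarrow> edge_count A B + t = t * b + a"
    unfolding ec of_nat_mult[symmetric] by linarith+
  have G': "bipartition G B A" using G(2) unfolding bipartition_def by (metis Int_commute Un_commute insert_commute)
  have ext: "int (card (edges G)) = int t * int b + (int a - int t)"
    if iso: "G \<simeq>\<^sub>g pendant_extension t a b f" and f: "\<And>i. i \<in> {t..<a} \<Longrightarrow> f i < b" for f
  proof -
    have "card (edges G) = t * b + (a - t)"
      using graph_iso_card_edges[OF G(1) pendant_extension_simple iso] f ta
        pendant_extension_card_edges[of t a b f] by simp
    then show ?thesis using ta by simp
  qed
  have struct: "(\<exists>f. (\<forall>i\<in>{t..<a}. f i < b) \<and> G \<simeq>\<^sub>g pendant_extension t a b f) \<and>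
      (odd k \<longrightarrow> G \<simeq>\<^sub>g pendant_extension t a b (\<lambda>_. 0))"
    if eq: "int (card (edges G)) = int t * int b + (int a - int t)"
  proof -
    have "pendant_structure t A B \<or> a = b \<and> pendant_structure t B A"
      using ex eq arith(2) a b by simp
    then show ?thesis
    proof
      assume "pendant_structure t A B"
      note S = pendant_structure_graph[OF G a b this]
      show ?thesis using S t2 ta ab free odd by auto
    next
      \<comment> \<open>With equal class sizes the pendant vertices may lie in \<open>B\<close>; an
        isomorphism does not record which class is which, so the same target graph results.\<close>
      assume "a = b \<and> pendant_structure t B A"
      then have ba: "card B = a" "card A = b" and "pendant_structure t B A" using a b by auto
      note S = pendant_structure_graph[OF G(1) G' ba this(3)]
      show ?thesis using S t2 ta ab free sw_free odd by auto
    qed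
  qed
  have "odd k \<longrightarrow> (int (card (edges G)) = int t * int b + (int a - int t) \<longleftrightarrow> G \<simeq>\<^sub>g B1_graph a b k)"
    using struct ext[of "\<lambda>_. 0"] tk ta ab by (auto simp: B1_graph_def)
  moreover have "(int (card (edges G)) = int t * int b + (int a - int t) \<longleftrightarrow>
      (\<exists>H\<in>B1_family a b k. G \<simeq>\<^sub>g H))"
    unfolding B1_family_def tk[symmetric] using struct ext by auto
  ultimately show ?thesis using ex arith(1) a b by blast
qed

end
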